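(* Let $\mathbf G_2$ be the set of all unlabelled 2-graphs and consider the formal series $$X=\sum_{\Gamma\in\mathbf G_2}\frac{\Gamma}{|\mathrm{Aut}\,\Gamma|},\qquad X^{\gamma}=\sum_{\substack{\Gamma\in\mathbf G_2\ \text{connected}\\ \partial\Gamma\cong\gamma}}\frac{\Gamma}{|\mathrm{Aut}\,\Gamma|}$$ for an unlabelled 1-graph $\gamma$. Then, with $\Delta$ extended termwise to formal series, $$\Delta X=\sum_{\Gamma\in\mathbf G_2}\Big(\prod_{v\in\mathcal V_\Gamma}|\mathrm{Aut}\,\gamma_v|\,X^{\gamma_v}\Big)\otimes\frac{\Gamma}{|\mathrm{Aut}\,\Gamma|},$$ where $\gamma_v$ is the vertex graph of the vertex $v$ of $\Gamma$, $\mathrm{Aut}\,\gamma_v$ its group of 1-graph automorphisms, and the product on the left tensor factor is disjoint union.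
   Context: A 1-graph is $(\mathcal V,\mathcal H,\nu,\iota)$: finite sets, $\nu:\mathcal H\to\mathcal V$, $\iota$ an involution of $\mathcal H$; a 1-graph isomorphism is a pair of bijections intertwining $\nu$ and $\iota$. A 2-graph is $G=(\mathcal V,\mathcal H,\nu,\iota;\mathcal S,\mu,\sigma_1,\sigma_2)$: a 1-graph plus a finite set $\mathcal S$ of strand sections, $\mu:\mathcal S\to\mathcal H$, a fixed-point free involution $\sigma_1$ of $\mathcal S$ with $\nu\circ\mu\circ\sigma_1=\nu\circ\mu$, and an involution $\sigma_2$ of $\mathcal S$ with $\iota\circ\mu=\mu\circ\sigma_2$ such that $s$ is fixed by $\sigma_2$ iff $\mu(s)$ is fixed by $\iota$. Edges are two-element orbits of $\iota$, edge strands two-element orbits of $\sigma_2$; fixed points are external. Connectedness refers to the underlying 1-graph. The vertex graph of $v$ is the 1-graph $\gamma_v=(\nu^{-1}(v),(\nu\circ\mu)^{-1}(v),\mu|,\sigma_1|)$. A subgraph $H\subseteq G$ differs from $G$ only in having a subset of the edges and correspondingly a subset of the edge strands (the others becoming external). An external face of $H$ is a tuple $(s_1,\dots,s_{2n})$ of distinct strand sections with $s_{2i}=\sigma_1(s_{2i-1})$, $s_{2i+1}=\sigma_{2,H}(s_{2i})$, $s_1,s_{2n}$ fixed by $\sigma_{2,H}$. The contraction $G/H$ has vertices the connected components of $H$, half-edges and strand sections the external ones of $H$, $\nu$ mapping to the component, $\mu$ restricted, edges and edge strands those of $G$ not in $H$, and $\sigma_1$ pairing $s_1$ with $s_{2n}$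 for each external face of $H$. 2-graph isomorphisms are triples of bijections of vertices, half-edges, strand sections intertwining all structure; unlabelled 2-graphs are isomorphism classes and $\mathrm{Aut}\,\Gamma$ is the automorphism group. The boundary of a connected 2-graph $\Gamma$ is $\partial\Gamma:=$ the vertex graph of the single vertex of $\Gamma/\Gamma$. $\mathcal G$ is the $\mathbb Q$-algebra with basis the unlabelled 2-graphs, product disjoint union (unit the empty 2-graph), with coproduct $\Delta(\Gamma)=\sum_{\Theta\subseteq\Gamma}\Theta\otimes\Gamma/\Theta$ (sum over subgraphs of a representative); formal series are infinite linear combinations of basis elements (resp. of tensors of basis elements), and the coefficients in the identity are finite. *)

theory Defs
  imports "HOL-Analysis.Infinite_Sum" "HOL-Library.FuncSet"
begin

section \<open>1-graphs\<close>

text \<open>Vertices, half-edges are labelled by natural numbers (every finite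
structure has such a representative; only isomorphism classes matter).\<close>

record g1 =
  V1 :: "nat set"
  H1 :: "nat set"
  nu1 :: "nat \<Rightarrow> nat"
  iota1 :: "nat \<Rightarrow> nat"

definition wf1 :: "g1 \<Rightarrow> bool" where
  "wf1 g \<longleftrightarrow> finite (V1 g) \<and> finite (H1 g) \<and>
     (\<forall>h\<in>H1 g. nu1 g h \<in> V1 g \<and> iota1 g h \<in> H1 g \<and> iota1 g (iota1 g h) = h)"

text \<open>Isomorphisms as pairs of bijections between the carriers (extensional,
so that distinct isomorphisms are distinct pairs of functions).\<close>
definition iso1_maps :: "g1 \<Rightarrow> g1 \<Rightarrow> ((nat \<Rightarrow> nat) \<times> (nat \<Rightarrow> nat)) set" where
  "iso1_maps g g' = {(f, k). f \<in> extensional (V1 g) \<and> k \<in> extensional (H1 g) \<and>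
      bij_betw f (V1 g) (V1 g') \<and> bij_betw k (H1 g) (H1 g') \<and>
      (\<forall>h\<in>H1 g. f (nu1 g h) = nu1 g' (k h) \<and> k (iota1 g h) = iota1 g' (k h))}"

definition iso1 :: "g1 \<Rightarrow> g1 \<Rightarrow> bool" where
  "iso1 g g' \<longleftrightarrow> iso1_maps g g' \<noteq> {}"

definition aut1 :: "g1 \<Rightarrow> nat" where
  "aut1 g = card (iso1_maps g g)"

section \<open>2-graphs\<close>

record g2 =
  gV :: "nat set"
  gH :: "nat set"
  gS :: "nat set"
  gnu :: "nat \<Rightarrow> nat"
  giota :: "nat \<Rightarrow> nat"
  gmu :: "nat \<Rightarrow> nat"
  gs1 :: "nat \<Rightarrow> nat"
  gs2 :: "nat \<Rightarrow> nat"

definition wf2 :: "g2 \<Rightarrow> bool" where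
  "wf2 G \<longleftrightarrow> finite (gV G) \<and> finite (gH G) \<and> finite (gS G) \<and>
     (\<forall>h\<in>gH G. gnu G h \<in> gV G \<and> giota G h \<in> gH G \<and> giota G (giota G h) = h) \<and>
     (\<forall>s\<in>gS G. gmu G s \<in> gH G \<and>
        gs1 G s \<in> gS G \<and> gs1 G (gs1 G s) = s \<and> gs1 G s \<noteq> s \<and>
        gnu G (gmu G (gs1 G s)) = gnu G (gmu G s) \<and>
        gs2 G s \<in> gS G \<and> gs2 G (gs2 G s) = s \<and>
        giota G (gmu G s) = gmu G (gs2 G s) \<and>
        (gs2 G s = s \<longleftrightarrow> giota G (gmu G s) = gmu G s))"

definition iso2_maps :: "g2 \<Rightarrow> g2 \<Rightarrow> ((nat \<Rightarrow> nat) \<times> (nat \<Rightarrow> nat) \<times> (nat \<Rightarrow> nat)) set" where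
  "iso2_maps G G' = {(f, k, m). f \<in> extensional (gV G) \<and> k \<in> extensional (gH G) \<and>
      m \<in> extensional (gS G) \<and>
      bij_betw f (gV G) (gV G') \<and> bij_betw k (gH G) (gH G') \<and> bij_betw m (gS G) (gS G') \<and>
      (\<forall>h\<in>gH G. f (gnu G h) = gnu G' (k h) \<and> k (giota G h) = giota G' (k h)) \<and>
      (\<forall>s\<in>gS G. k (gmu G s) = gmu G' (m s) \<and> m (gs1 G s) = gs1 G' (m s) \<and>
                 m (gs2 G s) = gs2 G' (m s))}"

definition iso2 :: "g2 \<Rightarrow> g2 \<Rightarrow> bool" where
  "iso2 G G' \<longleftrightarrow> iso2_maps G G' \<noteq> {}"

definition aut2 :: "g2 \<Rightarrow> nat" where
  "aut2 G = card (iso2_maps G G)"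

text \<open>Unlabelled 2-graphs = isomorphism classes of well-formed 2-graphs.\<close>
definition cls2 :: "g2 \<Rightarrow> g2 set" where
  "cls2 G = {G'. wf2 G' \<and> iso2 G G'}"

definition U2 :: "g2 set set" where
  "U2 = cls2 ` {G. wf2 G}"

definition rep2 :: "g2 set \<Rightarrow> g2" where
  "rep2 c = (SOME G. G \<in> c)"

section \<open>Subgraphs, connectedness, contraction, vertex graphs, boundary\<close>

definition edge_hes :: "g2 \<Rightarrow> nat set" where
  "edge_hes G = {h \<in> gH G. giota G h \<noteq> h}"

text \<open>A subgraph is determined by the set K of half-edges lying in its edges
(a union of edges of G).\<close>
definition subgraph_sets :: "g2 \<Rightarrow> nat set set" where
  "subgraph_sets G = {K. K \<subseteq> edge_hes G \<and> giota G ` K \<subseteq> K}"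

definition sub :: "g2 \<Rightarrow> nat set \<Rightarrow> g2" where
  "sub G K = G\<lparr> giota := (\<lambda>h. if h \<in> K then giota G h else h),
                gs2 := (\<lambda>s. if gmu G s \<in> K then gs2 G s else s) \<rparr>"

definition adj :: "g2 \<Rightarrow> (nat \<times> nat) set" where
  "adj G = {(gnu G h, gnu G (giota G h)) | h. h \<in> gH G}"

definition comp :: "g2 \<Rightarrow> nat \<Rightarrow> nat set" where
  "comp G v = {w. (v, w) \<in> (adj G)\<^sup>*}"

definition connected2 :: "g2 \<Rightarrow> bool" where
  "connected2 G \<longleftrightarrow> gV G \<noteq> {} \<and> (\<forall>v\<in>gV G. \<forall>w\<in>gV G. (v, w) \<in> (adj G)\<^sup>*)"

text \<open>End s_{2n} of the external face starting at the external strand section s.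
With phi = sigma2 o sigma1 one has s_{2k} = sigma1 (phi^(k-1) s).\<close>
definition face_end :: "g2 \<Rightarrow> nat \<Rightarrow> nat" where
  "face_end G s = (let phi = (\<lambda>x. gs2 G (gs1 G x));
      k = (LEAST k. gs2 G (gs1 G ((phi ^^ k) s)) = gs1 G ((phi ^^ k) s))
    in gs1 G ((phi ^^ k) s))"

text \<open>Contraction G/H for H = sub G K; a connected component is labelled by
its least vertex.\<close>
definition contract :: "g2 \<Rightarrow> nat set \<Rightarrow> g2" where
  "contract G K = (let Hs = sub G K in
     \<lparr> gV = (\<lambda>v. Min (comp Hs v)) ` gV G,
       gH = {h \<in> gH G. giota Hs h = h},
       gS = {s \<in> gS G. gs2 Hs s = s},
       gnu = (\<lambda>h. Min (comp Hs (gnu G h))),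
       giota = giota G,
       gmu = gmu G,
       gs1 = face_end Hs,
       gs2 = gs2 G \<rparr>)"

definition vgraph :: "g2 \<Rightarrow> nat \<Rightarrow> g1" where
  "vgraph G v = \<lparr> V1 = {h \<in> gH G. gnu G h = v},
                  H1 = {s \<in> gS G. gnu G (gmu G s) = v},
                  nu1 = gmu G,
                  iota1 = gs1 G \<rparr>"

definition boundary :: "g2 \<Rightarrow> g1" where
  "boundary G = (let Q = contract G (edge_hes G) in vgraph Q (the_elem (gV Q)))"

section \<open>Disjoint union and the empty 2-graph\<close>

definition lift2 :: "(nat \<Rightarrow> nat) \<Rightarrow> (nat \<Rightarrow> nat) \<Rightarrow> nat \<Rightarrow> nat" where
  "lift2 f f' x = (if even x then 2 * f (x div 2) else 2 * f' (x div 2) + 1)"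

definition dset :: "nat set \<Rightarrow> nat set \<Rightarrow> nat set" where
  "dset A B = (\<lambda>x. 2 * x) ` A \<union> (\<lambda>x. 2 * x + 1) ` B"

definition dunion :: "g2 \<Rightarrow> g2 \<Rightarrow> g2" where
  "dunion G G' = \<lparr> gV = dset (gV G) (gV G'), gH = dset (gH G) (gH G'),
     gS = dset (gS G) (gS G'), gnu = lift2 (gnu G) (gnu G'),
     giota = lift2 (giota G) (giota G'), gmu = lift2 (gmu G) (gmu G'),
     gs1 = lift2 (gs1 G) (gs1 G'), gs2 = lift2 (gs2 G) (gs2 G') \<rparr>"

definition empty2 :: g2 where
  "empty2 = \<lparr> gV = {}, gH = {}, gS = {}, gnu = id, giota = id, gmu = id,
              gs1 = id, gs2 = id \<rparr>"

section \<open>Formal series (coefficient functions on unlabelled 2-graphs)\<close>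

type_synonym series = "g2 set \<Rightarrow> real"

text \<open>Product in G (disjoint union) extended to formal series.\<close>
definition smul :: "series \<Rightarrow> series \<Rightarrow> series" where
  "smul A B d = (\<Sum>\<^sub>\<infinity>(p, q) \<in> {(p, q). p \<in> U2 \<and> q \<in> U2 \<and>
                       cls2 (dunion (rep2 p) (rep2 q)) = d}. A p * B q)"

definition sone :: series where
  "sone d = (if d = cls2 empty2 then 1 else 0)"

definition sprod :: "series list \<Rightarrow> series" where
  "sprod xs = foldr smul xs sone"

text \<open>X = sum of Gamma / |Aut Gamma|.\<close>
definition Xall :: series where
  "Xall c = 1 / real (aut2 (rep2 c))"

text \<open>X^gamma: connected Gamma with boundary isomorphic to gamma.\<close>
definition Xbd :: "g1 \<Rightarrow> series" where
  "Xbd \<gamma> c = (if connected2 (rep2 c) \<and> iso1 (boundary (rep2 c)) \<gamma>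
               then 1 / real (aut2 (rep2 c)) else 0)"

text \<open>Coefficient of a \<otimes> b in Delta(G).\<close>
definition delta_coeff :: "g2 \<Rightarrow> g2 set \<Rightarrow> g2 set \<Rightarrow> nat" where
  "delta_coeff G a b = card {K \<in> subgraph_sets G. cls2 (sub G K) = a \<and> cls2 (contract G K) = b}"

end

theory Submission
  imports Defs
begin

text \<open>Fix representatives \<open>A\<close>, \<open>B\<close> of the two basis elements. Let \<open>B\<^sub>0\<close> be \<open>B\<close> with all its edges cut, and
  \<open>R = A/A\<close> the edgeless residue of \<open>A\<close>. Both coefficients of \<open>A \<otimes> B\<close> equal
  \<open>|Iso(B\<^sub>0, R)| / (|Aut A| |Aut B|)\<close>.

  On the left, a pair of a 2-graph and a subgraph isomorphic to \<open>A\<close> amounts to a way of adding edges to \<open>A\<close>,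
  weighted by \<open>1/|Aut A|\<close>; adding edges to \<open>A\<close> is the same as adding edges to \<open>R\<close>, and the wirings
  of \<open>R\<close> that produce a copy of \<open>B\<close> are, up to \<open>Aut B\<close>, the isomorphisms from \<open>B\<^sub>0\<close> to \<open>R\<close>.

  On the right, one vertex of \<open>B\<close> is split off at a time: an isomorphism from a disjoint union \<open>P \<squnion> Q\<close> with
  connected \<open>P\<close> chooses the component onto which \<open>P\<close> is mapped. Applied to 2-graphs this computes
  the product of series, and applied to \<open>B\<^sub>0\<close> and \<open>R\<close> it splits \<open>Iso(B\<^sub>0, R)\<close> in the same way, since the vertices of
  \<open>R\<close> are the components of \<open>A\<close> and their vertex graphs are the boundaries.\<close>

section \<open>The groupoid of 2-graphs\<close>

text \<open>As a rewrite rule, the compatibility of the two edge involutions turns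
  \<open>giota G (gmu G s)\<close> into \<open>gmu G (gs2 G s)\<close>. For this reason the
  condition on external strand sections is stated for \<open>gmu G (gs2 G s)\<close>; steps that
  must keep \<open>giota\<close> switch rule 14 off.\<close>

lemma wf2_simps [simp]:
  assumes "wf2 G"
  shows "finite (gV G)" "finite (gH G)" "finite (gS G)"
    and "h \<in> gH G \<Longrightarrow> gnu G h \<in> gV G"
    and "h \<in> gH G \<Longrightarrow> giota G h \<in> gH G"
    and "h \<in> gH G \<Longrightarrow> giota G (giota G h) = h"
    and "s \<in> gS G \<Longrightarrow> gmu G s \<in> gH G"
    and "s \<in> gS G \<Longrightarrow> gs1 G s \<in> gS G"
    and "s \<in> gS G \<Longrightarrow> gs1 G (gs1 G s) = s"
    and "s \<in> gS G \<Longrightarrow> gs1 G s \<noteq> s"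
    and "s \<in> gS G \<Longrightarrow> gnu G (gmu G (gs1 G s)) = gnu G (gmu G s)"
    and "s \<in> gS G \<Longrightarrow> gs2 G s \<in> gS G"
    and "s \<in> gS G \<Longrightarrow> gs2 G (gs2 G s) = s"
    and "s \<in> gS G \<Longrightarrow> giota G (gmu G s) = gmu G (gs2 G s)"
    and "s \<in> gS G \<Longrightarrow> gmu G (gs2 G s) = gmu G s \<longleftrightarrow> gs2 G s = s"
  using assms by (simp_all add: wf2_def)

text \<open>The conditions of \<open>iso2_maps\<close> without extensionality, so that composition,
  \<open>id\<close> and \<open>inv_into\<close> apply directly. The extensional form, in which
  isomorphisms can be counted, is recovered by \<open>restrict\<close>.\<close>

definition iso_triple ::
  "g2 \<Rightarrow> g2 \<Rightarrow> (nat \<Rightarrow> nat) \<Rightarrow> (nat \<Rightarrow> nat) \<Rightarrow> (nat \<Rightarrow> nat) \<Rightarrow> bool" where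
  "iso_triple G G' f k m \<longleftrightarrow>
      bij_betw f (gV G) (gV G') \<and> bij_betw k (gH G) (gH G') \<and> bij_betw m (gS G) (gS G') \<and>
      (\<forall>h\<in>gH G. f (gnu G h) = gnu G' (k h) \<and> k (giota G h) = giota G' (k h)) \<and>
      (\<forall>s\<in>gS G. k (gmu G s) = gmu G' (m s) \<and> m (gs1 G s) = gs1 G' (m s) \<and>
                 m (gs2 G s) = gs2 G' (m s))"

lemma iso_tripleD:
  assumes "iso_triple G G' f k m"
  shows "bij_betw f (gV G) (gV G')" "bij_betw k (gH G) (gH G')" "bij_betw m (gS G) (gS G')"
    and "h \<in> gH G \<Longrightarrow> f (gnu G h) = gnu G' (k h)"
    and "h \<in> gH G \<Longrightarrow> k (giota G h) = giota G' (k h)"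
    and "s \<in> gS G \<Longrightarrow> k (gmu G s) = gmu G' (m s)"
    and "s \<in> gS G \<Longrightarrow> m (gs1 G s) = gs1 G' (m s)"
    and "s \<in> gS G \<Longrightarrow> m (gs2 G s) = gs2 G' (m s)"
    and "v \<in> gV G \<Longrightarrow> f v \<in> gV G'" "h \<in> gH G \<Longrightarrow> k h \<in> gH G'" "s \<in> gS G \<Longrightarrow> m s \<in> gS G'"
  using assms unfolding iso_triple_def by (auto dest: bij_betwE)

lemma iso2_maps_iff:
  "(f, k, m) \<in> iso2_maps G G' \<longleftrightarrow>
     f \<in> extensional (gV G) \<and> k \<in> extensional (gH G) \<and> m \<in> extensional (gS G) \<and>
     iso_triple G G' f k m"
  by (auto simp: iso2_maps_def iso_triple_def)

lemma iso_triple_cong: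
  assumes "wf2 G" "iso_triple G G' f k m"
    and "\<And>v. v \<in> gV G \<Longrightarrow> f' v = f v" "\<And>h. h \<in> gH G \<Longrightarrow> k' h = k h" "\<And>s. s \<in> gS G \<Longrightarrow> m' s = m s"
  shows "iso_triple G G' f' k' m'"
  using assms unfolding iso_triple_def
  by (simp cong: bij_betw_cong)

lemma iso_triple_restrict:
  assumes "wf2 G" "iso_triple G G' f k m"
  shows "(restrict f (gV G), restrict k (gH G), restrict m (gS G)) \<in> iso2_maps G G'"
  unfolding iso2_maps_iff using iso_triple_cong[OF assms] by auto

lemma iso2_iff:
  assumes "wf2 G"
  shows "iso2 G G' \<longleftrightarrow> (\<exists>f k m. iso_triple G G' f k m)"
proof
  assume "iso2 G G'"
  then obtain x where "x \<in> iso2_maps G G'" by (auto simp: iso2_def)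
  then show "\<exists>f k m. iso_triple G G' f k m" by (cases x) (auto simp: iso2_maps_iff)
next
  assume "\<exists>f k m. iso_triple G G' f k m"
  then show "iso2 G G'" using iso_triple_restrict[OF assms] unfolding iso2_def by blast
qed

lemma iso_triple_trans:
  assumes "iso_triple G G' f k m" "iso_triple G' G'' f' k' m'"
  shows "iso_triple G G'' (f' \<circ> f) (k' \<circ> k) (m' \<circ> m)"
  using assms iso_tripleD(9-11)[OF assms(1)] unfolding iso_triple_def
  by (auto intro: bij_betw_trans)

lemma iso_triple_inv:
  assumes "wf2 G" "iso_triple G G' f k m"
  shows "iso_triple G' G (inv_into (gV G) f) (inv_into (gH G) k) (inv_into (gS G) m)"
proof -
  note D = iso_tripleD[OF assms(2)]
  have i: "inj_on f (gV G)" "inj_on k (gH G)" "inj_on m (gS G)"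
    and im: "gV G' = f ` gV G" "gH G' = k ` gH G" "gS G' = m ` gS G"
    using D(1-3) by (auto simp: bij_betw_def)
  have "inv_into (gV G) f (gnu G' (k h)) = gnu G h" "inv_into (gH G) k (giota G' (k h)) = giota G h"
    if "h \<in> gH G" for h
    using that assms(1) i by (simp_all add: D(4,5)[symmetric])
  moreover have "inv_into (gH G) k (gmu G' (m s)) = gmu G s"
      "inv_into (gS G) m (gs1 G' (m s)) = gs1 G s" "inv_into (gS G) m (gs2 G' (m s)) = gs2 G s"
    if "s \<in> gS G" for s
    using that assms(1) i by (simp_all add: D(6-8)[symmetric])
  ultimately show ?thesis
    using D(1-3) i unfolding iso_triple_def im by (auto intro: bij_betw_inv_into)
qed

lemma iso_triple_id: "wf2 G \<Longrightarrow> iso_triple G G id id id"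
  by (simp add: iso_triple_def bij_betw_def)

lemma iso2_refl: "wf2 G \<Longrightarrow> iso2 G G"
  using iso_triple_id iso2_iff by blast

lemma iso2_sym: "wf2 G \<Longrightarrow> wf2 G' \<Longrightarrow> iso2 G G' \<Longrightarrow> iso2 G' G"
  using iso_triple_inv iso2_iff by blast

lemma iso2_trans: "wf2 G \<Longrightarrow> wf2 G' \<Longrightarrow> iso2 G G' \<Longrightarrow> iso2 G' G'' \<Longrightarrow> iso2 G G''"
  using iso_triple_trans iso2_iff by meson

text \<open>The axioms compare values of the structure maps, and \<open>f\<close>, \<open>k\<close>,
  \<open>m\<close> are injective and commute with these maps, so each axiom can be checked in
  \<open>G'\<close>. What injectivity cannot give is that the carriers of \<open>G\<close> are
  closed under its maps; this is assumed.\<close>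

lemma wf2_pullback:
  assumes "wf2 G'" "iso_triple G G' f k m"
    and "\<And>h. h \<in> gH G \<Longrightarrow> gnu G h \<in> gV G \<and> giota G h \<in> gH G"
    and "\<And>s. s \<in> gS G \<Longrightarrow> gmu G s \<in> gH G \<and> gs1 G s \<in> gS G \<and> gs2 G s \<in> gS G"
  shows "wf2 G"
proof -
  note D = iso_tripleD[OF assms(2)]
  have f: "x = y" if "f x = f y" "x \<in> gV G" "y \<in> gV G" for x y
    using D(1) that by (auto simp: bij_betw_def dest: inj_onD)
  have k: "x = y" if "k x = k y" "x \<in> gH G" "y \<in> gH G" for x y
    using D(2) that by (auto simp: bij_betw_def dest: inj_onD)
  have m: "x = y" if "m x = m y" "x \<in> gS G" "y \<in> gS G" for x y
    using D(3) that by (auto simp: bij_betw_def dest: inj_onD)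
  have fin: "finite (gV G)" "finite (gH G)" "finite (gS G)"
    using D(1-3) assms(1) by (auto simp: bij_betw_finite)
  have 1: "giota G (giota G h) = h" if "h \<in> gH G" for h
    by (rule k) (simp_all add: assms(1,3) D that)
  have 2: "gs1 G (gs1 G s) = s" "gs1 G s \<noteq> s" "gnu G (gmu G (gs1 G s)) = gnu G (gmu G s)"
     "gs2 G (gs2 G s) = s" "giota G (gmu G s) = gmu G (gs2 G s)" if s: "s \<in> gS G" for s
  proof -
    note S = assms(3,4) D assms(1) s
    show "gs1 G (gs1 G s) = s" by (rule m) (simp_all add: S)
    have "m (gs1 G s) \<noteq> m s" by (simp add: S)
    then show "gs1 G s \<noteq> s" by auto
    show "gnu G (gmu G (gs1 G s)) = gnu G (gmu G s)" by (rule f) (simp_all add: S)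
    show "gs2 G (gs2 G s) = s" by (rule m) (simp_all add: S)
    show "giota G (gmu G s) = gmu G (gs2 G s)" by (rule k) (simp_all add: S)
  qed
  have 3: "gs2 G s = s \<longleftrightarrow> gmu G (gs2 G s) = gmu G s" if s: "s \<in> gS G" for s
  proof -
    have in2: "gs2 G s \<in> gS G" "gmu G (gs2 G s) \<in> gH G" "gmu G s \<in> gH G"
      using assms(4) s by blast+
    have "gs2 G s = s \<longleftrightarrow> m (gs2 G s) = m s" using m[OF _ in2(1) s] by auto
    also have "\<dots> \<longleftrightarrow> gmu G' (gs2 G' (m s)) = gmu G' (m s)"
      using wf2_simps(15)[OF assms(1) D(11)[OF s]] by (simp add: D(8) s)
    also have "\<dots> \<longleftrightarrow> k (gmu G (gs2 G s)) = k (gmu G s)" by (simp add: D(6,8) in2 s)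
    also have "\<dots> \<longleftrightarrow> gmu G (gs2 G s) = gmu G s" using k[OF _ in2(2,3)] by auto
    finally show ?thesis .
  qed
  have 4: "gs2 G s = s \<longleftrightarrow> giota G (gmu G s) = gmu G s" if "s \<in> gS G" for s
    using 2(5)[OF that] 3[OF that] by simp
  show ?thesis unfolding wf2_def
    using fin assms(3,4) 1 2 4 by (intro conjI ballI) blast+
qed

section \<open>Counting isomorphisms\<close>

lemma finite_iso2_maps: "wf2 G \<Longrightarrow> finite (gV G') \<Longrightarrow> finite (gH G') \<Longrightarrow> finite (gS G') \<Longrightarrow> finite (iso2_maps G G')"
proof -
  assume a: "wf2 G" "finite (gV G')" "finite (gH G')" "finite (gS G')"
  have "iso2_maps G G' \<subseteq> (gV G \<rightarrow>\<^sub>E gV G') \<times> (gH G \<rightarrow>\<^sub>E gH G') \<times> (gS G \<rightarrow>\<^sub>E gS G')"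
    by (auto simp: iso2_maps_iff PiE_def dest: iso_tripleD)
  then show ?thesis
    by (rule finite_subset) (use a in \<open>intro finite_cartesian_product finite_PiE; simp\<close>)
qed

text \<open>Composing with a fixed isomorphism from \<open>G'\<close> to \<open>G''\<close> is
  injective because its components are injective. The inverse isomorphism gives the opposite
  inequality.\<close>

lemma card_iso2_maps_target_le:
  assumes "wf2 G" "wf2 G''" "iso_triple G' G'' f k m"
  shows "card (iso2_maps G G') \<le> card (iso2_maps G G'')"
proof (rule card_inj_on_le)
  let ?c = "\<lambda>(f', k', m'). (compose (gV G) f f', compose (gH G) k k', compose (gS G) m m')"
  note D = iso_tripleD[OF assms(3)]
  show "inj_on ?c (iso2_maps G G')"
  proof (rule inj_onI)
    fix x y assume xy: "x \<in> iso2_maps G G'" "y \<in> iso2_maps G G'" "?c x = ?c y"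
    obtain f1 k1 m1 f2 k2 m2 where x: "x = (f1, k1, m1)" and y: "y = (f2, k2, m2)"
      by (metis prod.exhaust)
    have 1: "(f1, k1, m1) \<in> iso2_maps G G'" and 2: "(f2, k2, m2) \<in> iso2_maps G G'"
      using xy x y by auto
    have eq: "compose (gV G) f f1 = compose (gV G) f f2" "compose (gH G) k k1 = compose (gH G) k k2"
        "compose (gS G) m m1 = compose (gS G) m m2"
      using xy(3) by (simp_all add: x y)
    have l: "g1 = g2" if "compose A c g1 = compose A c g2" "inj_on c B" "g1 \<in> extensional A"
       "g2 \<in> extensional A" "\<And>x. x \<in> A \<Longrightarrow> g1 x \<in> B \<and> g2 x \<in> B" for g1 g2 c A B
    proof (rule extensionalityI[OF that(3,4)])
      fix x assume x: "x \<in> A"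
      then have "c (g1 x) = c (g2 x)" using fun_cong[OF that(1), of x] by (simp add: compose_def)
      then show "g1 x = g2 x" using that(2,5) x by (auto dest: inj_onD)
    qed
    have "f1 = f2 \<and> k1 = k2 \<and> m1 = m2"
      using eq 1 2 D(1-3) unfolding iso2_maps_iff
      by (intro conjI; elim l) (auto simp: bij_betw_def dest: iso_tripleD)
    then show "x = y" by (simp add: x y)
  qed
  show "?c ` iso2_maps G G' \<subseteq> iso2_maps G G''"
  proof (clarify)
    fix f1 k1 m1 assume 1: "(f1, k1, m1) \<in> iso2_maps G G'"
    have "iso_triple G G'' (f \<circ> f1) (k \<circ> k1) (m \<circ> m1)"
      using 1 assms(3) iso_triple_trans iso2_maps_iff by blast
    from iso_triple_restrict[OF assms(1) this]
    show "(compose (gV G) f f1, compose (gH G) k k1, compose (gS G) m m1) \<in> iso2_maps G G''"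
      by (simp add: compose_def o_def restrict_def)
  qed
  show "finite (iso2_maps G G'')" using assms by (simp add: finite_iso2_maps)
qed

lemma card_iso2_maps_target:
  assumes "wf2 G" "wf2 G'" "wf2 G''" "iso2 G' G''"
  shows "card (iso2_maps G G') = card (iso2_maps G G'')"
proof -
  obtain f k m where "iso_triple G' G'' f k m" using assms iso2_iff by blast
  then show ?thesis
    using assms(1-3) iso_triple_inv[OF assms(2)] by (intro order_antisym card_iso2_maps_target_le)
qed

text \<open>An extensional bijection is determined by its inverse, so inversion is injective;
  exchanging the two graphs gives equality.\<close>

lemma card_iso2_maps_inverse_le:
  assumes "wf2 G" "wf2 G'"
  shows "card (iso2_maps G G') \<le> card (iso2_maps G' G)"
proof (rule card_inj_on_le)
  let ?c = "\<lambda>(f, k, m). (restrict (inv_into (gV G) f) (gV G'), restrict (inv_into (gH G) k) (gH G'),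
     restrict (inv_into (gS G) m) (gS G'))"
  show "inj_on ?c (iso2_maps G G')"
  proof (rule inj_onI)
    fix x y assume xy: "x \<in> iso2_maps G G'" "y \<in> iso2_maps G G'" "?c x = ?c y"
    obtain f1 k1 m1 f2 k2 m2 where x: "x = (f1, k1, m1)" and y: "y = (f2, k2, m2)"
      by (metis prod.exhaust)
    have 1: "(f1, k1, m1) \<in> iso2_maps G G'" and 2: "(f2, k2, m2) \<in> iso2_maps G G'"
      using xy x y by auto
    have eq: "restrict (inv_into (gV G) f1) (gV G') = restrict (inv_into (gV G) f2) (gV G')"
        "restrict (inv_into (gH G) k1) (gH G') = restrict (inv_into (gH G) k2) (gH G')"
        "restrict (inv_into (gS G) m1) (gS G') = restrict (inv_into (gS G) m2) (gS G')"
      using xy(3) by (simp_all only: x y case_prod_conv prod.inject)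
    have l: "g1 = g2" if eq: "restrict (inv_into A g1) B = restrict (inv_into A g2) B"
      and b: "bij_betw g1 A B" "bij_betw g2 A B" and e: "g1 \<in> extensional A" "g2 \<in> extensional A"
      for g1 g2 :: "nat \<Rightarrow> nat" and A B
    proof (rule extensionalityI[OF e])
      fix x assume x: "x \<in> A"
      then have "g1 x \<in> B" using b by (auto dest: bij_betwE)
      then have "inv_into A g2 (g1 x) = inv_into A g1 (g1 x)" using fun_cong[OF eq, of "g1 x"] by simp
      also have "\<dots> = x" using x b by (simp add: bij_betw_def)
      finally show "g1 x = g2 x"
        using \<open>g1 x \<in> B\<close> b(2) bij_betw_inv_into_right by fastforce
    qed
    have "f1 = f2 \<and> k1 = k2 \<and> m1 = m2"
      using eq 1 2 unfolding iso2_maps_iff by (intro conjI; elim l) (auto dest: iso_tripleD)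
    then show "x = y" by (simp add: x y)
  qed
  show "?c ` iso2_maps G G' \<subseteq> iso2_maps G' G"
    using iso_triple_inv[OF assms(1)] iso_triple_restrict[OF assms(2)] by (auto simp: iso2_maps_iff)
  show "finite (iso2_maps G' G)" using assms by (simp add: finite_iso2_maps)
qed

lemma card_iso2_maps_commute:
  assumes "wf2 G" "wf2 G'"
  shows "card (iso2_maps G G') = card (iso2_maps G' G)"
  using card_iso2_maps_inverse_le assms by (simp add: order_antisym)

lemma card_iso2_maps_source:
  assumes "wf2 G" "wf2 G'" "wf2 G''" "iso2 G' G''"
  shows "card (iso2_maps G' G) = card (iso2_maps G'' G)"
  using card_iso2_maps_target[OF assms] card_iso2_maps_commute[OF assms(1)] assms(2,3) by simp

text \<open>A nonempty set of isomorphisms from \<open>G\<close> to \<open>G'\<close> is a torsor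
  under the automorphisms of \<open>G\<close>. The counts below use this to trade the condition of
  being isomorphic for a number of isomorphisms.\<close>

lemma card_iso2_maps_eq_aut2:
  assumes "wf2 G" "wf2 G'"
  shows "card (iso2_maps G G') = (if iso2 G G' then aut2 G else 0)"
proof (cases "iso2 G G'")
  case True
  then show ?thesis
    using card_iso2_maps_target[OF assms(1,1,2)] by (simp add: aut2_def)
qed (simp add: iso2_def)

lemma aut2_pos: "wf2 G \<Longrightarrow> aut2 G > 0"
  using iso2_refl[of G] by (simp add: aut2_def card_gt_0_iff finite_iso2_maps iso2_def)

lemma aut2_cong: "wf2 G \<Longrightarrow> wf2 G' \<Longrightarrow> iso2 G G' \<Longrightarrow> aut2 G = aut2 G'"
  using card_iso2_maps_source[of G' G G'] card_iso2_maps_eq_aut2[of G G'] by (simp add: aut2_def)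

section \<open>Unlabelled 2-graphs and their representatives\<close>

lemma cls2_eq_iff: "wf2 G \<Longrightarrow> wf2 G' \<Longrightarrow> cls2 G = cls2 G' \<longleftrightarrow> iso2 G G'"
proof
  assume "wf2 G" "wf2 G'" "cls2 G = cls2 G'"
  then show "iso2 G G'" using iso2_refl[of G'] by (auto simp: cls2_def)
next
  assume "wf2 G" "wf2 G'" "iso2 G G'"
  then show "cls2 G = cls2 G'"
    unfolding cls2_def by (auto intro: iso2_trans iso2_sym)
qed

lemma U2_I [simp]: "wf2 G \<Longrightarrow> cls2 G \<in> U2"
  by (simp add: U2_def)

lemma rep2_props:
  assumes "c \<in> U2"
  shows "wf2 (rep2 c)" "cls2 (rep2 c) = c"
proof -
  obtain G where G: "wf2 G" "c = cls2 G" using assms by (auto simp: U2_def)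
  then have "G \<in> c" using iso2_refl by (simp add: cls2_def)
  then have "rep2 c \<in> c" unfolding rep2_def by (rule someI)
  then have "wf2 (rep2 c)" "iso2 G (rep2 c)" using G by (auto simp: cls2_def)
  then show "wf2 (rep2 c)" "cls2 (rep2 c) = c" 
    using G cls2_eq_iff iso2_sym by auto
qed

lemma iso2_rep2:
  assumes "wf2 G" shows "wf2 (rep2 (cls2 G))" "iso2 G (rep2 (cls2 G))"
  using rep2_props[of "cls2 G"] cls2_eq_iff[of G "rep2 (cls2 G)"] assms by auto

section \<open>Components\<close>

lemma adj_in_gV: "wf2 G \<Longrightarrow> (v, w) \<in> adj G \<Longrightarrow> v \<in> gV G \<and> w \<in> gV G"
  by (auto simp: adj_def)

lemma sym_adj: "wf2 G \<Longrightarrow> sym (adj G)"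
proof (rule symI)
  fix v w assume G: "wf2 G" and "(v, w) \<in> adj G"
  then obtain h where "h \<in> gH G" "v = gnu G h" "w = gnu G (giota G h)" by (auto simp: adj_def)
  then have "giota G h \<in> gH G \<and> w = gnu G (giota G h) \<and> v = gnu G (giota G (giota G h))"
    using G by simp
  then show "(w, v) \<in> adj G" unfolding adj_def by blast
qed

lemma comp_self [simp]: "v \<in> comp G v"
  by (simp add: comp_def)

lemma comp_subset:
  assumes "wf2 G" "v \<in> gV G" shows "comp G v \<subseteq> gV G"
proof
  fix w assume "w \<in> comp G v"
  then have "(v, w) \<in> (adj G)\<^sup>*" by (simp add: comp_def)
  then show "w \<in> gV G" by induction (use assms adj_in_gV in auto)
qed

lemma comp_eq:
  assumes "wf2 G" "w \<in> comp G v" shows "comp G w = comp G v"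
proof -
  have vw: "(v, w) \<in> (adj G)\<^sup>*" using assms by (simp add: comp_def)
  then have "(w, v) \<in> (adj G)\<^sup>*" using sym_adj[OF assms(1)] by (metis sym_rtrancl symD)
  with vw show ?thesis unfolding comp_def by (auto intro: rtrancl_trans)
qed

lemma comp_edge: "wf2 G \<Longrightarrow> h \<in> gH G \<Longrightarrow> comp G (gnu G (giota G h)) = comp G (gnu G h)"
  by (rule comp_eq) (auto simp: comp_def adj_def)

text \<open>The name that \<open>contract\<close> gives to the component of a vertex in the
  contracted subgraph.\<close>

definition min_label :: "g2 \<Rightarrow> nat \<Rightarrow> nat" where
  "min_label G v = Min (comp G v)"

lemma min_label_in_comp:
  assumes "wf2 G" "v \<in> gV G" shows "min_label G v \<in> comp G v"
proof -
  have "finite (comp G v)" using assms by (intro finite_subset[OF comp_subset]) simp_all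
  moreover have "comp G v \<noteq> {}" using comp_self[of v G] by blast
  ultimately show ?thesis unfolding min_label_def by (rule Min_in)
qed

lemma min_label_eq_iff:
  assumes "wf2 G" "v \<in> gV G" "w \<in> gV G"
  shows "min_label G v = min_label G w \<longleftrightarrow> comp G v = comp G w"
proof
  assume "min_label G v = min_label G w"
  then have "min_label G v \<in> comp G v" "min_label G v \<in> comp G w"
    using min_label_in_comp[OF assms(1)] assms(2,3) by metis+
  then show "comp G v = comp G w" using comp_eq[OF assms(1)] by metis
qed (simp add: min_label_def)

lemma comp_min_label: "wf2 G \<Longrightarrow> v \<in> gV G \<Longrightarrow> comp G (min_label G v) = comp G v"
  by (rule comp_eq[OF _ min_label_in_comp])

lemma min_label_in_gV: "wf2 G \<Longrightarrow> v \<in> gV G \<Longrightarrow> min_label G v \<in> gV G"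
  using min_label_in_comp comp_subset by blast

lemma min_label_idem: "wf2 G \<Longrightarrow> v \<in> gV G \<Longrightarrow> min_label G (min_label G v) = min_label G v"
  using comp_min_label by (simp add: min_label_def)

lemma comp_image_subset:
  assumes "wf2 G" "iso_triple G G' f k m" "v \<in> gV G"
  shows "f ` comp G v \<subseteq> comp G' (f v)"
proof -
  have "(f v, f w) \<in> (adj G')\<^sup>*" if "(v, w) \<in> (adj G)\<^sup>*" for w
    using that
  proof induction
    case (step y z)
    then obtain h where h: "h \<in> gH G" "y = gnu G h" "z = gnu G (giota G h)" by (auto simp: adj_def)
    have "f y = gnu G' (k h)" "f z = gnu G' (giota G' (k h))" "k h \<in> gH G'"
      using h assms(1) iso_tripleD[OF assms(2)] by simp_all
    then have "(f y, f z) \<in> adj G'" by (auto simp: adj_def)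
    with step.IH show ?case by simp
  qed simp
  then show ?thesis by (auto simp: comp_def)
qed

lemma comp_image:
  assumes "wf2 G" "wf2 G'" "iso_triple G G' f k m" "v \<in> gV G"
  shows "comp G' (f v) = f ` comp G v"
proof
  let ?g = "inv_into (gV G) f"
  note D = iso_tripleD[OF assms(3)]
  have gf: "?g (f v) = v" using D(1) assms(4) by (simp add: bij_betw_def)
  have sub: "?g ` comp G' (f v) \<subseteq> comp G v"
    using comp_image_subset[OF assms(2) iso_triple_inv[OF assms(1,3)], of "f v"] gf D(9) assms(4) by simp
  show "comp G' (f v) \<subseteq> f ` comp G v"
  proof
    fix w assume w: "w \<in> comp G' (f v)"
    then have "w \<in> gV G'" using comp_subset[OF assms(2)] D(9) assms(4) by blast
    then have "f (?g w) = w" using D(1) bij_betw_inv_into_right by fastforce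
    then show "w \<in> f ` comp G v" using sub w by (metis imageI subsetD)
  qed
qed (use comp_image_subset assms in blast)

lemma connected2_iff:
  assumes "wf2 G"
  shows "connected2 G \<longleftrightarrow> gV G \<noteq> {} \<and> (\<forall>v\<in>gV G. comp G v = gV G)"
proof -
  have "comp G v = gV G \<longleftrightarrow> (\<forall>w\<in>gV G. (v, w) \<in> (adj G)\<^sup>*)" if "v \<in> gV G" for v
    using comp_subset[OF assms that] by (auto simp: comp_def)
  then show ?thesis unfolding connected2_def by simp
qed

lemma connected2_iso:
  assumes "wf2 G" "wf2 G'" "iso2 G G'" "connected2 G"
  shows "connected2 G'"
proof -
  obtain f k m where i: "iso_triple G G' f k m" using assms iso2_iff by blast
  have V: "gV G' = f ` gV G" using iso_tripleD(1)[OF i] by (simp add: bij_betw_def)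
  show ?thesis
    using assms(4) comp_image[OF assms(1,2) i]
    by (auto simp: connected2_iff assms(1,2) V)
qed

section \<open>External faces\<close>

text \<open>These are the strand sections with odd index in the face that starts at
  \<open>s\<close>: step \<open>k\<close> is the member with index 2k+1.\<close>

primrec face_iter :: "g2 \<Rightarrow> nat \<Rightarrow> nat \<Rightarrow> nat" where
  "face_iter G s 0 = s"
| "face_iter G s (Suc k) = gs2 G (gs1 G (face_iter G s k))"

text \<open>In the numbering of the face, the member with index 2k+2 is external, so the face can
  end there; the least such \<open>k\<close> gives its end.\<close>

definition face_stop :: "g2 \<Rightarrow> nat \<Rightarrow> nat \<Rightarrow> bool" where
  "face_stop G s k \<longleftrightarrow> gs2 G (gs1 G (face_iter G s k)) = gs1 G (face_iter G s k)"

lemma face_end_eq: "face_end G s = gs1 G (face_iter G s (LEAST k. face_stop G s k))"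
proof -
  have "((\<lambda>x. gs2 G (gs1 G x)) ^^ k) s = face_iter G s k" for k by (induction k) simp_all
  then show ?thesis by (simp add: face_end_def face_stop_def Let_def)
qed

lemma face_iter_in: "wf2 G \<Longrightarrow> s \<in> gS G \<Longrightarrow> face_iter G s k \<in> gS G"
  by (induction k) simp_all

text \<open>\<open>gs2 \<circ> gs1\<close> permutes the strand sections, so the iteration returns to \<open>s\<close>; since \<open>s\<close> is
  external, the face ends at the latest one step before that.\<close>

lemma face_stop_ex:
  assumes G: "wf2 G" and s: "s \<in> gS G" and ext: "gs2 G s = s"
  shows "\<exists>k. face_stop G s k"
proof -
  have inj: "x = y" if "gs2 G (gs1 G x) = gs2 G (gs1 G y)" "x \<in> gS G" "y \<in> gS G" for x y
    using that G by (metis wf2_simps(8,9,13))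
  have "\<not> inj_on (\<lambda>k. face_iter G s k) UNIV"
  proof
    assume "inj_on (\<lambda>k. face_iter G s k) UNIV"
    moreover have "range (\<lambda>k. face_iter G s k) \<subseteq> gS G" using face_iter_in[OF G s] by auto
    ultimately show False using G by (metis infinite_UNIV_nat finite_imageD finite_subset wf2_simps(3))
  qed
  then obtain i j where "face_iter G s i = face_iter G s j" "i < j"
    unfolding inj_on_def by (metis linorder_neqE_nat UNIV_I)
  then have "\<exists>n>0. face_iter G s n = s"
  proof (induction i arbitrary: j)
    case 0 then show ?case by auto
  next
    case (Suc i)
    then obtain j' where j': "j = Suc j'" "i < j'" using Suc_lessE by blast
    have "face_iter G s i = face_iter G s j'"
      by (rule inj) (use Suc.prems j' face_iter_in[OF G s] in simp_all)
    then show ?case using Suc.IH j'(2) by blast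
  qed
  then obtain n where "face_iter G s (Suc n) = s" by (metis gr0_conv_Suc)
  then have "gs2 G (gs1 G (face_iter G s n)) = s" by simp
  moreover have "gs1 G (face_iter G s n) \<in> gS G" using G s by (simp add: face_iter_in)
  ultimately have "gs1 G (face_iter G s n) = s" using G ext by (metis wf2_simps(13))
  then have "face_stop G s n" using ext by (simp add: face_stop_def)
  then show ?thesis ..
qed

lemma face_end_in:
  assumes "wf2 G" "s \<in> gS G" "gs2 G s = s"
  shows "face_end G s \<in> gS G" "gs2 G (face_end G s) = face_end G s"
  using LeastI_ex[OF face_stop_ex[OF assms]] assms(1,2) face_iter_in
  by (simp_all add: face_end_eq face_stop_def)

text \<open>Both \<open>gs1\<close> and \<open>gs2\<close> are involutions, so the walk from the end
  retraces the face. The members at which double steps start in one direction are the images under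
  \<open>gs1\<close> of those in the other, which accounts for the \<open>gs1\<close> on the
  right.\<close>

lemma face_end_reverse:
  assumes G: "wf2 G" and s: "s \<in> gS G" and ext: "gs2 G s = s"
  defines "t \<equiv> face_end G s" and "k \<equiv> LEAST k. face_stop G s k"
  shows "j \<le> k \<Longrightarrow> face_iter G t j = gs1 G (face_iter G s (k - j))"
proof (induction j)
  case 0 then show ?case by (simp add: t_def k_def face_end_eq)
next
  case (Suc j)
  let ?y = "face_iter G s (k - Suc j)"
  have y: "?y \<in> gS G" using G s by (rule face_iter_in)
  have "k - j = Suc (k - Suc j)" using Suc.prems by simp
  then have e: "face_iter G s (k - j) = gs2 G (gs1 G ?y)" by simp
  have "face_iter G t (Suc j) = gs2 G (gs1 G (gs1 G (face_iter G s (k - j))))"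
    using Suc by simp
  then show ?case using y G unfolding e by simp
qed

text \<open>By reversal, a stop of the walk from the end before step \<open>k\<close> would be a
  stop of the original walk before step \<open>k\<close>, against minimality; at step
  \<open>k\<close> the walk reaches \<open>s\<close>, which is external.\<close>

lemma face_end_involution:
  assumes G: "wf2 G" and s: "s \<in> gS G" and ext: "gs2 G s = s"
  shows "face_end G (face_end G s) = s" "face_end G s \<noteq> s"
proof -
  define k where "k = (LEAST k. face_stop G s k)"
  let ?t = "face_end G s" and ?p = "face_iter G s"
  note it = face_iter_in[OF G s]
  have rev: "face_iter G ?t j = gs1 G (?p (k - j))" if "j \<le> k" for j
    using face_end_reverse[OF assms] that by (simp add: k_def)
  have nostop: "\<not> face_stop G s j" if "j < k" for j using that not_less_Least k_def by blast
  have rstop: "face_stop G ?t j \<longleftrightarrow> gs2 G (?p (k - j)) = ?p (k - j)" if "j \<le> k" for j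
    using G it by (simp add: face_stop_def rev[OF that])
  have "\<not> face_stop G ?t j" if "j < k" for j
  proof -
    have e: "?p (k - j) = gs2 G (gs1 G (?p (k - Suc j)))"
    proof -
      have "k - j = Suc (k - Suc j)" using that by simp
      then show ?thesis by simp
    qed
    have "gs2 G (gs1 G (?p (k - Suc j))) \<noteq> gs1 G (?p (k - Suc j))"
      using nostop[of "k - Suc j"] that by (simp add: face_stop_def)
    then have "gs2 G (?p (k - j)) \<noteq> ?p (k - j)" using e G it by simp
    then show ?thesis using rstop that by simp
  qed
  moreover have "face_stop G ?t k" using rstop[of k] ext by simp
  ultimately have "(LEAST j. face_stop G ?t j) = k"
    by (intro Least_equality) (auto simp: not_less[symmetric])
  then have "face_end G ?t = gs1 G (face_iter G ?t k)" by (simp add: face_end_eq)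
  also have "\<dots> = s" using rev[of k] G s by simp
  finally show "face_end G ?t = s" .
  show "?t \<noteq> s"
  proof
    assume t: "?t = s"
    \<comment> \<open>If the face were its own reverse, its middle would be a strand section fixed
      by \<open>gs1\<close> when \<open>k\<close> is even, and a stop before step \<open>k\<close>
      when \<open>k\<close> is odd.\<close>
    obtain j where "k = 2 * j \<or> k = Suc (2 * j)" by (metis oddE evenE Suc_eq_plus1)
    then show False
    proof
      assume "k = 2 * j"
      then have "?p j = gs1 G (?p j)" using rev[of j] t by (simp add: mult_2)
      then show False using G it[of j] by (metis wf2_simps(10))
    next
      assume k: "k = Suc (2 * j)"
      then have "?p (Suc j) = gs1 G (?p j)" using rev[of "Suc j"] t by (simp add: mult_2)
      then have "face_stop G s j" by (simp add: face_stop_def)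
      then show False using nostop[of j] k by simp
    qed
  qed
qed

text \<open>Along a face, \<open>gs1\<close> stays at the vertex and \<open>gs2\<close> follows an
  edge or does nothing.\<close>

lemma face_end_comp:
  assumes G: "wf2 G" and s: "s \<in> gS G"
  shows "comp G (gnu G (gmu G (face_end G s))) = comp G (gnu G (gmu G s))"
proof -
  have "comp G (gnu G (gmu G (face_iter G s k))) = comp G (gnu G (gmu G s))" for k
  proof (induction k)
    case (Suc k)
    let ?x = "gs1 G (face_iter G s k)"
    have x: "?x \<in> gS G" using G s by (simp add: face_iter_in)
    have "gmu G (gs2 G ?x) = giota G (gmu G ?x)" using G x by simp
    then have "comp G (gnu G (gmu G (gs2 G ?x))) = comp G (gnu G (gmu G ?x))"
      using comp_edge[OF G, of "gmu G ?x"] G x by (simp del: wf2_simps(14))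
    also have "\<dots> = comp G (gnu G (gmu G s))" using Suc G s by (simp add: face_iter_in)
    finally show ?case by simp
  qed simp
  then show ?thesis using G s by (simp add: face_end_eq face_iter_in)
qed

text \<open>An isomorphism carries one walk to the other step by step, and injectivity of
  \<open>m\<close> makes the two walks stop for the first time at the same step.\<close>

lemma face_end_iso:
  assumes G: "wf2 G" and i: "iso_triple G G' f k m" and s: "s \<in> gS G"
  shows "face_end G' (m s) = m (face_end G s)"
proof -
  note D = iso_tripleD[OF i] and it = face_iter_in[OF G s]
  have p: "face_iter G' (m s) n = m (face_iter G s n)" for n
    by (induction n) (use G it in \<open>simp_all flip: D(6-8)\<close>)
  have "face_stop G' (m s) n \<longleftrightarrow> face_stop G s n" for n
  proof -
    have "face_stop G' (m s) n \<longleftrightarrow> m (gs2 G (gs1 G (face_iter G s n))) = m (gs1 G (face_iter G s n))"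
      using G it by (simp add: face_stop_def p flip: D(6-8))
    also have "\<dots> \<longleftrightarrow> face_stop G s n"
      using D(3) G it by (auto simp: face_stop_def bij_betw_def dest: inj_onD)
    finally show ?thesis .
  qed
  then show ?thesis using G it by (simp add: face_end_eq p flip: D(6-8))
qed

section \<open>Contractions\<close>

text \<open>The contraction of all edges of \<open>G\<close>, that is \<open>G/G\<close>, written
  with the data of \<open>G\<close> itself. Only external half-edges and strand sections survive, so
  \<open>giota\<close> and \<open>gs2\<close> fix everything in the carriers.\<close>

definition residue :: "g2 \<Rightarrow> g2" where
  "residue G = \<lparr> gV = min_label G ` gV G, gH = {h \<in> gH G. giota G h = h},
     gS = {s \<in> gS G. gs2 G s = s}, gnu = (\<lambda>h. min_label G (gnu G h)), giota = giota G,
     gmu = gmu G, gs1 = face_end G, gs2 = gs2 G \<rparr>"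

lemma residue_sel [simp]:
  "gV (residue G) = min_label G ` gV G" "gH (residue G) = {h \<in> gH G. giota G h = h}"
  "gS (residue G) = {s \<in> gS G. gs2 G s = s}" "gnu (residue G) h = min_label G (gnu G h)"
  "giota (residue G) = giota G" "gmu (residue G) = gmu G" "gs1 (residue G) = face_end G"
  "gs2 (residue G) = gs2 G"
  by (simp_all add: residue_def)

definition rewire :: "g2 \<Rightarrow> (nat \<Rightarrow> nat) \<Rightarrow> (nat \<Rightarrow> nat) \<Rightarrow> g2" where
  "rewire G i t = G\<lparr> giota := i, gs2 := t \<rparr>"

lemma rewire_sel [simp]:
  "gV (rewire G i t) = gV G" "gH (rewire G i t) = gH G" "gS (rewire G i t) = gS G"
  "gnu (rewire G i t) = gnu G" "giota (rewire G i t) = i" "gmu (rewire G i t) = gmu G"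
  "gs1 (rewire G i t) = gs1 G" "gs2 (rewire G i t) = t"
  by (simp_all add: rewire_def)

lemma sub_sel [simp]:
  "gV (sub G K) = gV G" "gH (sub G K) = gH G" "gS (sub G K) = gS G" "gnu (sub G K) = gnu G"
  "giota (sub G K) h = (if h \<in> K then giota G h else h)" "gmu (sub G K) = gmu G"
  "gs1 (sub G K) = gs1 G" "gs2 (sub G K) s = (if gmu G s \<in> K then gs2 G s else s)"
  by (simp_all add: sub_def)

text \<open>The edge involutions of the residue of \<open>H\<close> are trivial on its carriers,
  while in \<open>G/H\<close> the remaining half-edges are joined as in \<open>G\<close>. The
  statements on contractions below are reduced to residues in this way.\<close>

lemma contract_eq: "contract G K = rewire (residue (sub G K)) (giota G) (gs2 G)"
  by (simp add: contract_def rewire_def residue_def sub_def min_label_def Let_def)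

lemma wf2_rewire:
  assumes "wf2 G"
    and "\<And>h. h \<in> gH G \<Longrightarrow> i h \<in> gH G \<and> i (i h) = h"
    and "\<And>s. s \<in> gS G \<Longrightarrow> t s \<in> gS G \<and> t (t s) = s \<and> i (gmu G s) = gmu G (t s)"
    and "\<And>s. s \<in> gS G \<Longrightarrow> i (gmu G s) = gmu G s \<Longrightarrow> t s = s"
  shows "wf2 (rewire G i t)"
proof -
  have "t s = s \<longleftrightarrow> i (gmu G s) = gmu G s" if "s \<in> gS G" for s
    using assms(3,4)[OF that] by auto
  then show ?thesis unfolding wf2_def using assms(1-3) by simp
qed

lemma iso_triple_rewire:
  assumes "iso_triple G G' f k m"
    and "\<And>h. h \<in> gH G \<Longrightarrow> k (i h) = i' (k h)" "\<And>s. s \<in> gS G \<Longrightarrow> m (t s) = t' (m s)"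
  shows "iso_triple (rewire G i t) (rewire G' i' t') f k m"
  using assms unfolding iso_triple_def by simp

text \<open>The properties of \<open>face_end\<close> are the axioms for \<open>gs1\<close> here: it
  sends external strand sections to external ones, is a fixed-point free involution, and does not
  leave a component.\<close>

lemma wf2_residue:
  assumes "wf2 G" shows "wf2 (residue G)"
proof -
  have "gnu (residue G) (gmu G (face_end G s)) = gnu (residue G) (gmu G s)"
    if "s \<in> gS G" for s
    using face_end_comp[OF assms that] by (simp add: min_label_def)
  then show ?thesis
    unfolding wf2_def using assms by (auto simp: face_end_in face_end_involution)
qed

lemma bij_betw_Collect:
  assumes "bij_betw f A B" "\<And>x. x \<in> A \<Longrightarrow> P x \<longleftrightarrow> Q (f x)"
  shows "bij_betw f {x \<in> A. P x} {y \<in> B. Q y}"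
  using assms unfolding bij_betw_def by (auto simp: inj_on_def)

text \<open>Both sides name the image of the component of \<open>v\<close>. An isomorphism need not
  respect the order of the labels, so the image of a least vertex is again replaced by the least
  vertex of its component.\<close>

lemma min_label_iso:
  assumes "wf2 G" "wf2 G'" "iso_triple G G' f k m" "v \<in> gV G"
  shows "min_label G' (f (min_label G v)) = min_label G' (f v)"
  using assms comp_image[OF assms(1-3)] comp_min_label min_label_in_gV
  by (simp add: min_label_def)

lemma iso_triple_residue:
  assumes G: "wf2 G" and G': "wf2 G'" and i: "iso_triple G G' f k m"
  shows "iso_triple (residue G) (residue G') (\<lambda>x. min_label G' (f x)) k m"
proof -
  note D = iso_tripleD[OF i]
  have inj: "inj_on f (gV G)" and V': "gV G' = f ` gV G"
    and ik: "inj_on k (gH G)" and im: "inj_on m (gS G)"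
    using D(1-3) by (simp_all add: bij_betw_def)
  have "bij_betw (\<lambda>x. min_label G' (f x)) (min_label G ` gV G) (min_label G' ` gV G')"
    unfolding bij_betw_def
  proof
    show "inj_on (\<lambda>x. min_label G' (f x)) (min_label G ` gV G)"
    proof (rule inj_onI, elim imageE)
      fix x y v w assume e: "min_label G' (f x) = min_label G' (f y)"
        and x: "x = min_label G v" "v \<in> gV G" and y: "y = min_label G w" "w \<in> gV G"
      have "min_label G' (f v) = min_label G' (f w)" using e x y min_label_iso[OF assms] by simp
      then have "f ` comp G v = f ` comp G w"
        using x y D(9) by (simp add: min_label_eq_iff[OF G'] flip: comp_image[OF assms])
      then have "comp G v = comp G w"
        using inj_on_image_eq_iff[OF inj] comp_subset[OF G] x y by metis
      then show "x = y" using x y by (simp add: min_label_def)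
    qed
    show "(\<lambda>x. min_label G' (f x)) ` min_label G ` gV G = min_label G' ` gV G'"
      using min_label_iso[OF assms] by (auto simp: V' image_image)
  qed
  moreover have "giota G h = h \<longleftrightarrow> giota G' (k h) = k h" if "h \<in> gH G" for h
    using ik that G by (auto simp flip: D(5) dest: inj_onD)
  moreover have "gs2 G s = s \<longleftrightarrow> gs2 G' (m s) = m s" if "s \<in> gS G" for s
    using im that G by (auto simp flip: D(8) dest: inj_onD)
  ultimately show ?thesis
    using D min_label_iso[OF assms] face_end_iso[OF G i] G
    unfolding iso_triple_def by (auto intro!: bij_betw_Collect)
qed

section \<open>Subgraphs\<close>

lemma subgraph_setsD:
  assumes "wf2 G" "K \<in> subgraph_sets G"
  shows "h \<in> K \<Longrightarrow> h \<in> gH G" "h \<in> K \<Longrightarrow> giota G h \<noteq> h"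
    and "h \<in> gH G \<Longrightarrow> giota G h \<in> K \<longleftrightarrow> h \<in> K"
proof -
  show 1: "h \<in> K \<Longrightarrow> h \<in> gH G" "h \<in> K \<Longrightarrow> giota G h \<noteq> h"
    using assms by (auto simp: subgraph_sets_def edge_hes_def)
  show "h \<in> gH G \<Longrightarrow> giota G h \<in> K \<longleftrightarrow> h \<in> K"
    using assms by (auto simp: subgraph_sets_def)
qed

lemma wf2_sub:
  assumes G: "wf2 G" and K: "K \<in> subgraph_sets G"
  shows "wf2 (sub G K)"
proof -
  note S = subgraph_setsD[OF assms]
  have mu: "gmu G (gs2 G s) \<in> K \<longleftrightarrow> gmu G s \<in> K" if "s \<in> gS G" for s
    using S(3)[of "gmu G s"] G that by simp
  show ?thesis unfolding wf2_def using G S mu by auto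
qed

lemma contract_fixed:
  assumes G: "wf2 G" and K: "K \<in> subgraph_sets G"
  shows "gH (contract G K) = gH G - K" "gS (contract G K) = {s \<in> gS G. gmu G s \<notin> K}"
proof -
  have "gs2 G s \<noteq> s" if "s \<in> gS G" "gmu G s \<in> K" for s
  proof
    assume "gs2 G s = s"
    then have "giota G (gmu G s) = gmu G s" using G that by simp
    then show False using subgraph_setsD(2)[OF assms that(2)] by blast
  qed
  then show "gH (contract G K) = gH G - K" "gS (contract G K) = {s \<in> gS G. gmu G s \<notin> K}"
    using subgraph_setsD[OF assms] by (auto simp: contract_eq)
qed

lemma wf2_contract:
  assumes G: "wf2 G" and K: "K \<in> subgraph_sets G"
  shows "wf2 (contract G K)"
proof -
  have *: "gH (residue (sub G K)) = gH G - K" "gS (residue (sub G K)) = {s \<in> gS G. gmu G s \<notin> K}"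
    using contract_fixed[OF assms] by (simp_all only: contract_eq rewire_sel)
  have mu: "gmu G (gs2 G s) \<in> K \<longleftrightarrow> gmu G s \<in> K" if "s \<in> gS G" for s
    using subgraph_setsD(3)[OF assms, of "gmu G s"] G that by simp
  show ?thesis
    unfolding contract_eq
    by (rule wf2_rewire[OF wf2_residue[OF wf2_sub[OF assms]]])
      (use G subgraph_setsD(3)[OF assms] mu in \<open>simp_all only: *\<close>, auto)
qed

lemma edge_hes_in_subgraph_sets: "wf2 G \<Longrightarrow> edge_hes G \<in> subgraph_sets G"
  by (auto simp: subgraph_sets_def edge_hes_def)

lemma edge_hes_image:
  assumes "wf2 G" "iso_triple G G' f k m"
  shows "edge_hes G' = k ` edge_hes G"
proof -
  note D = iso_tripleD[OF assms(2)]
  have "bij_betw k {h \<in> gH G. giota G h \<noteq> h} {h \<in> gH G'. giota G' h \<noteq> h}"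
  proof (rule bij_betw_Collect[OF D(2)])
    fix h assume h: "h \<in> gH G"
    have "k (giota G h) = k h \<longleftrightarrow> giota G h = h"
      using D(2) h assms(1) by (auto simp: bij_betw_def dest: inj_onD)
    then show "giota G h \<noteq> h \<longleftrightarrow> giota G' (k h) \<noteq> k h" using D(5) h by simp
  qed
  then show ?thesis by (simp add: bij_betw_def edge_hes_def)
qed

lemma edge_hes_sub: "wf2 G \<Longrightarrow> K \<in> subgraph_sets G \<Longrightarrow> edge_hes (sub G K) = K"
  using subgraph_setsD[of G K] by (auto simp: edge_hes_def split: if_splits)

lemma subgraph_image:
  assumes G: "wf2 G" and G': "wf2 G'" and i: "iso_triple G G' f k m" and K: "K \<in> subgraph_sets G"
  shows "k ` K \<in> subgraph_sets G'" "iso_triple (sub G K) (sub G' (k ` K)) f k m"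
    and "iso_triple (contract G K) (contract G' (k ` K)) (\<lambda>x. min_label (sub G' (k ` K)) (f x)) k m"
proof -
  note D = iso_tripleD[OF i] and S = subgraph_setsD[OF G K]
  have mem: "k h \<in> k ` K \<longleftrightarrow> h \<in> K" if "h \<in> gH G" for h
    using D(2) that S(1) by (auto simp: bij_betw_def dest: inj_onD)
  show 1: "k ` K \<in> subgraph_sets G'"
    using K S(1,3) by (auto simp: subgraph_sets_def edge_hes_image[OF G i] simp flip: D(5))
  show 2: "iso_triple (sub G K) (sub G' (k ` K)) f k m"
    using i mem G unfolding iso_triple_def by (simp flip: D(6))
  show "iso_triple (contract G K) (contract G' (k ` K)) (\<lambda>x. min_label (sub G' (k ` K)) (f x)) k m"
    unfolding contract_eq
    by (rule iso_triple_rewire[OF iso_triple_residue[OF wf2_sub[OF G K] wf2_sub[OF G' 1] 2]])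
      (use D(5,8) in simp_all)
qed

section \<open>Counting the ways to add edges\<close>

definition bare :: "g2 \<Rightarrow> g2" where
  "bare G = rewire G (\<lambda>h. h) (\<lambda>s. s)"

lemma wf2_bare: "wf2 G \<Longrightarrow> wf2 (bare G)"
  unfolding bare_def by (rule wf2_rewire) auto

text \<open>The ways of adding edges to \<open>G\<close>: wirings of the same half-edges and strand
  sections that keep the existing edges and edge strands. Extensional functions make different
  wirings different pairs.\<close>

definition extensions :: "g2 \<Rightarrow> ((nat \<Rightarrow> nat) \<times> (nat \<Rightarrow> nat)) set" where
  "extensions G = {(i, t). i \<in> extensional (gH G) \<and> t \<in> extensional (gS G) \<and> wf2 (rewire G i t) \<and>
     (\<forall>h\<in>gH G. giota G h \<noteq> h \<longrightarrow> i h = giota G h) \<and>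
     (\<forall>s\<in>gS G. gs2 G s \<noteq> s \<longrightarrow> t s = gs2 G s)}"

lemma extensionsD:
  assumes "(i, t) \<in> extensions G"
  shows "i \<in> extensional (gH G)" "t \<in> extensional (gS G)" "wf2 (rewire G i t)"
    and "h \<in> gH G \<Longrightarrow> giota G h \<noteq> h \<Longrightarrow> i h = giota G h"
    and "s \<in> gS G \<Longrightarrow> gs2 G s \<noteq> s \<Longrightarrow> t s = gs2 G s"
    and "h \<in> gH G \<Longrightarrow> i h \<in> gH G" "h \<in> gH G \<Longrightarrow> i (i h) = h"
    and "s \<in> gS G \<Longrightarrow> t s \<in> gS G" "s \<in> gS G \<Longrightarrow> t (t s) = s"
    and "s \<in> gS G \<Longrightarrow> i (gmu G s) = gmu G (t s)"
    and "s \<in> gS G \<Longrightarrow> i (gmu G s) = gmu G s \<Longrightarrow> t s = s"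
proof -
  show wf: "wf2 (rewire G i t)" using assms by (simp add: extensions_def)
  show "i \<in> extensional (gH G)" "t \<in> extensional (gS G)"
    "h \<in> gH G \<Longrightarrow> giota G h \<noteq> h \<Longrightarrow> i h = giota G h" "s \<in> gS G \<Longrightarrow> gs2 G s \<noteq> s \<Longrightarrow> t s = gs2 G s"
    using assms by (simp_all add: extensions_def)
  note w = wf2_simps[OF wf, simplified]
  show "h \<in> gH G \<Longrightarrow> i h \<in> gH G" "h \<in> gH G \<Longrightarrow> i (i h) = h"
    "s \<in> gS G \<Longrightarrow> t s \<in> gS G" "s \<in> gS G \<Longrightarrow> t (t s) = s" "s \<in> gS G \<Longrightarrow> i (gmu G s) = gmu G (t s)"
    by (fact w)+
  show "s \<in> gS G \<Longrightarrow> i (gmu G s) = gmu G s \<Longrightarrow> t s = s"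
    using w(14,15)[of s] by simp
qed

lemma finite_extensions: "wf2 G \<Longrightarrow> finite (extensions G)"
proof -
  assume G: "wf2 G"
  have "extensions G \<subseteq> (gH G \<rightarrow>\<^sub>E gH G) \<times> (gS G \<rightarrow>\<^sub>E gS G)"
    by (auto simp: PiE_def extensionsD(1,2,6,8))
  then show ?thesis
    by (rule finite_subset) (use G in \<open>intro finite_cartesian_product finite_PiE; simp\<close>)
qed

text \<open>The old edges of the extended graph form a copy of \<open>G\<close>, and contracting
  them leaves the vertices of \<open>residue G\<close> joined by the new edges. All maps can be
  taken to be \<open>id\<close> because the components, and so their labels, are those of
  \<open>G\<close>.\<close>

lemma extension_subgraph:
  assumes G: "wf2 G" and e: "(i, t) \<in> extensions G"
  shows "edge_hes G \<in> subgraph_sets (rewire G i t)"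
    and "iso_triple G (sub (rewire G i t) (edge_hes G)) id id id"
    and "iso_triple (rewire (residue G) i t) (contract (rewire G i t) (edge_hes G)) id id id"
proof -
  note E = extensionsD[OF e]
  have mu: "gmu G s \<in> edge_hes G \<longleftrightarrow> gs2 G s \<noteq> s" if "s \<in> gS G" for s
    using that G by (simp add: edge_hes_def)
  show 1: "edge_hes G \<in> subgraph_sets (rewire G i t)"
    using G E(4) by (auto simp: subgraph_sets_def edge_hes_def)
  show 2: "iso_triple G (sub (rewire G i t) (edge_hes G)) id id id"
    using E(4,5) mu by (simp add: iso_triple_def edge_hes_def)
  let ?H = "sub (rewire G i t) (edge_hes G)"
  have "iso_triple (residue G) (residue ?H) (\<lambda>x. min_label ?H (id x)) id id"
    by (rule iso_triple_residue[OF G wf2_sub[OF E(3) 1] 2])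
  \<comment> \<open>The vertices of the residue are already least in their components, so the
    relabelling does nothing.\<close>
  moreover have "min_label ?H x = x" if "x \<in> gV (residue G)" for x
  proof -
    have "min_label ?H v = min_label G v" if "v \<in> gV G" for v
      using comp_image[OF G wf2_sub[OF E(3) 1] 2 that] by (simp add: min_label_def)
    then show ?thesis using that G min_label_idem min_label_in_gV by auto
  qed
  ultimately have "iso_triple (residue G) (residue ?H) id id id"
    using iso_triple_cong[OF wf2_residue[OF G]] by simp
  then show "iso_triple (rewire (residue G) i t) (contract (rewire G i t) (edge_hes G)) id id id"
    unfolding contract_eq by (rule iso_triple_rewire) simp_all
qed

text \<open>The added edges stay inside the carriers of the residue: an external half-edge of
  \<open>G\<close> cannot be joined to one on an old edge, since the involution already matches that
  one with its old partner. The same holds for strand sections.\<close>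

lemma wf2_rewire_residue:
  assumes G: "wf2 G" and e: "(i, t) \<in> extensions G"
  shows "wf2 (rewire (residue G) i t)"
proof -
  note E = extensionsD[OF e]
  have h: "giota G (i h) = i h" if "h \<in> gH G" "giota G h = h" for h
  proof (rule ccontr)
    assume n: "giota G (i h) \<noteq> i h"
    then have "i (i h) = giota G (i h)" using E that by simp
    then have "giota G h = i h" using G E that by (metis wf2_simps(6))
    then show False using n that by simp
  qed
  have s: "gs2 G (t s) = t s" if "s \<in> gS G" "gs2 G s = s" for s
  proof (rule ccontr)
    assume n: "gs2 G (t s) \<noteq> t s"
    then have "t (t s) = gs2 G (t s)" using E that by simp
    then have "gs2 G s = t s" using G E that by (metis wf2_simps(13))
    then show False using n that by simp
  qed
  show ?thesis
  proof (rule wf2_rewire[OF wf2_residue[OF G]])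
    show "i x \<in> gH (residue G) \<and> i (i x) = x" if "x \<in> gH (residue G)" for x
      using that by (simp add: E(6,7) h)
    show "t x \<in> gS (residue G) \<and> t (t x) = x \<and> i (gmu (residue G) x) = gmu (residue G) (t x)"
      if "x \<in> gS (residue G)" for x
      using that by (simp add: E(8-10) s)
    show "t x = x" if "x \<in> gS (residue G)" "i (gmu (residue G) x) = gmu (residue G) x" for x
      using that by (simp add: E(11))
  qed
qed

text \<open>An isomorphism from \<open>B\<close> onto the rewired residue is the same thing as an isomorphism of the
  edgeless skeletons: the wiring is then transported from \<open>B\<close>.\<close>

lemma card_extensions_contracting_to:
  assumes G: "wf2 G" and B: "wf2 B"
  shows "card {(i, t) \<in> extensions G. iso2 B (rewire (residue G) i t)} * aut2 B =
    card (iso2_maps (bare B) (residue G))"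
proof -
  let ?E = "extensions G" and ?M = "\<lambda>e. iso2_maps B (rewire (residue G) (fst e) (snd e))"
  note fE = finite_extensions[OF G]
  have wf: "wf2 (rewire (residue G) (fst e) (snd e))" if "e \<in> ?E" for e
    using wf2_rewire_residue[OF G] that by (metis prod.collapse)
  have "bij_betw snd (Sigma ?E ?M) (iso2_maps (bare B) (residue G))"
    unfolding bij_betw_def
  proof
    show "inj_on snd (Sigma ?E ?M)"
    proof (rule inj_onI)
      fix x y assume xy: "x \<in> Sigma ?E ?M" "y \<in> Sigma ?E ?M" "snd x = snd y"
      obtain i t f k m where x: "x = ((i, t), f, k, m)" by (metis prod.exhaust)
      obtain i' t' where y: "y = ((i', t'), f, k, m)" using xy(3) x by (metis prod.exhaust snd_conv)
      have e: "(i, t) \<in> ?E" "(i', t') \<in> ?E"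
        and I: "iso_triple B (rewire (residue G) i t) f k m" "iso_triple B (rewire (residue G) i' t') f k m"
        using xy x y by (auto simp: iso2_maps_iff)
      have "i = i'"
      proof (rule extensionalityI[OF extensionsD(1)[OF e(1)] extensionsD(1)[OF e(2)]])
        fix h assume h: "h \<in> gH G"
        show "i h = i' h"
        proof (cases "giota G h = h")
          case True
          then obtain h0 where "h0 \<in> gH B" "h = k h0"
            using iso_tripleD(2)[OF I(1)] h by (auto simp: bij_betw_def)
          then show ?thesis using iso_tripleD(5)[OF I(1)] iso_tripleD(5)[OF I(2)] by simp
        qed (simp add: h extensionsD(4)[OF e(1)] extensionsD(4)[OF e(2)])
      qed
      moreover have "t = t'"
      proof (rule extensionalityI[OF extensionsD(2)[OF e(1)] extensionsD(2)[OF e(2)]])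
        fix s assume s: "s \<in> gS G"
        show "t s = t' s"
        proof (cases "gs2 G s = s")
          case True
          then obtain s0 where "s0 \<in> gS B" "s = m s0"
            using iso_tripleD(3)[OF I(1)] s by (auto simp: bij_betw_def)
          then show ?thesis using iso_tripleD(8)[OF I(1)] iso_tripleD(8)[OF I(2)] by simp
        qed (simp add: s extensionsD(5)[OF e(1)] extensionsD(5)[OF e(2)])
      qed
      ultimately show "x = y" by (simp add: x y)
    qed
    show "snd ` Sigma ?E ?M = iso2_maps (bare B) (residue G)"
    proof (intro equalityI subsetI)
      fix z assume "z \<in> snd ` Sigma ?E ?M"
      then obtain i t where z: "z \<in> iso2_maps B (rewire (residue G) i t)" by auto
      obtain f k m where fkm: "z = (f, k, m)" by (metis prod.exhaust)
      have I: "iso_triple B (rewire (residue G) i t) f k m" using z fkm by (simp add: iso2_maps_iff)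
      have "giota G (k h) = k h" if "h \<in> gH B" for h using iso_tripleD(10)[OF I that] by simp
      moreover have "gs2 G (m s) = m s" if "s \<in> gS B" for s using iso_tripleD(11)[OF I that] by simp
      ultimately show "z \<in> iso2_maps (bare B) (residue G)"
        using z unfolding fkm iso2_maps_iff iso_triple_def bare_def by simp
    next
      fix z assume zin: "z \<in> iso2_maps (bare B) (residue G)"
      obtain f k m where z: "z = (f, k, m)" by (metis prod.exhaust)
      have I: "iso_triple (bare B) (residue G) f k m" using zin z by (simp add: iso2_maps_iff)
      note D = iso_tripleD[OF I]
      \<comment> \<open>The external half-edges of \<open>G\<close> receive the edges of
        \<open>B\<close> through \<open>k\<close>, the others keep their edges in \<open>G\<close>;
        \<open>t\<close> does the same for strand sections.\<close>
      define i where "i = restrict (\<lambda>h. if giota G h = h then k (giota B (inv_into (gH B) k h)) else giota G h) (gH G)"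
      define t where "t = restrict (\<lambda>s. if gs2 G s = s then m (gs2 B (inv_into (gS B) m s)) else gs2 G s) (gS G)"
      have bk: "bij_betw k (gH B) {h \<in> gH G. giota G h = h}" and bm: "bij_betw m (gS B) {s \<in> gS G. gs2 G s = s}"
        using D(2,3) by (simp_all add: bare_def)
      have kin: "k h \<in> gH G" "giota G (k h) = k h" if "h \<in> gH B" for h using bk that by (auto dest: bij_betwE)
      have min: "m s \<in> gS G" "gs2 G (m s) = m s" if "s \<in> gS B" for s using bm that by (auto dest: bij_betwE)
      have ik: "i (k h) = k (giota B h)" if "h \<in> gH B" for h
        using that kin[OF that] bk by (simp add: i_def bij_betw_def)
      have tm: "t (m s) = m (gs2 B s)" if "s \<in> gS B" for s
        using that min[OF that] bm by (simp add: t_def bij_betw_def)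
      have i0: "i h = giota G h" if "h \<in> gH G" "giota G h \<noteq> h" for h using that by (simp add: i_def)
      have t0: "t s = gs2 G s" if "s \<in> gS G" "gs2 G s \<noteq> s" for s using that by (simp add: t_def)
      have obk: "\<exists>h0\<in>gH B. h = k h0" if "h \<in> gH G" "giota G h = h" for h
        using bk that by (auto simp: bij_betw_def)
      have obm: "\<exists>s0\<in>gS B. s = m s0" if "s \<in> gS G" "gs2 G s = s" for s
        using bm that by (auto simp: bij_betw_def)
      have km: "gmu G (m s) = k (gmu B s)" if "s \<in> gS B" for s using D(6) that by (simp add: bare_def)
      have "wf2 (rewire G i t)"
      proof (rule wf2_rewire[OF G])
        fix h assume h: "h \<in> gH G"
        show "i h \<in> gH G \<and> i (i h) = h"
        proof (cases "giota G h = h")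
          case True
          then obtain h0 where "h0 \<in> gH B" "h = k h0" using obk h by blast
          then show ?thesis using B by (simp add: ik kin)
        next
          case False
          have "giota G (giota G h) \<noteq> giota G h" using False h G by simp
          then show ?thesis using False h G by (simp add: i0)
        qed
      next
        fix s assume s: "s \<in> gS G"
        show "t s \<in> gS G \<and> t (t s) = s \<and> i (gmu G s) = gmu G (t s)"
        proof (cases "gs2 G s = s")
          case True
          then obtain s0 where "s0 \<in> gS B" "s = m s0" using obm s by blast
          then show ?thesis using B by (simp add: tm min km ik)
        next
          case False
          then have "gs2 G (gs2 G s) \<noteq> gs2 G s" "giota G (gmu G s) \<noteq> gmu G s" using s G by simp_all
          then show ?thesis using False s G by (simp add: t0 i0)
        qed
      next
        fix s assume s: "s \<in> gS G" "i (gmu G s) = gmu G s"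
        show "t s = s"
        proof (cases "gs2 G s = s")
          case True
          then obtain s0 where s0: "s0 \<in> gS B" "s = m s0" using obm s by blast
          then have "k (giota B (gmu B s0)) = k (gmu B s0)" using s B by (simp add: km ik)
          then have "giota B (gmu B s0) = gmu B s0"
            using bk B s0 by (auto simp: bij_betw_def dest: inj_onD)
          then have "gs2 B s0 = s0" using B s0 by simp
          then show ?thesis using s0 by (simp add: tm)
        next
          case False
          then have "giota G (gmu G s) \<noteq> gmu G s" using s G by simp
          then have "i (gmu G s) \<noteq> gmu G s" using s G i0[of "gmu G s"] by (simp del: wf2_simps(14))
          then show ?thesis using s by simp
        qed
      qed
      then have "(i, t) \<in> ?E" using i0 t0 by (simp add: extensions_def i_def t_def)
      moreover have "z \<in> iso2_maps B (rewire (residue G) i t)"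
        using zin I by (simp add: z iso2_maps_iff iso_triple_def bare_def ik tm)
      ultimately have "((i, t), z) \<in> Sigma ?E ?M" by simp
      then show "z \<in> snd ` Sigma ?E ?M" by force
    qed
  qed
  then have "card (iso2_maps (bare B) (residue G)) = card (Sigma ?E ?M)"
    by (simp add: bij_betw_same_card)
  also have "\<dots> = (\<Sum>e\<in>?E. card (?M e))"
    using fE B wf G by (intro card_SigmaI) (auto intro!: finite_iso2_maps)
  \<comment> \<open>Counted by wirings: each contributes \<open>aut2 B\<close> isomorphisms if it
    yields a copy of \<open>B\<close>, and none otherwise.\<close>
  also have "\<dots> = (\<Sum>e\<in>?E. if iso2 B (rewire (residue G) (fst e) (snd e)) then aut2 B else 0)"
    using card_iso2_maps_eq_aut2[OF B wf] by simp
  also have "\<dots> = card {e \<in> ?E. iso2 B (rewire (residue G) (fst e) (snd e))} * aut2 B"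
    using fE by (simp add: sum.If_cases Int_def)
  also have "{e \<in> ?E. iso2 B (rewire (residue G) (fst e) (snd e))} =
      {(i, t) \<in> ?E. iso2 B (rewire (residue G) i t)}" by auto
  finally show ?thesis by simp
qed

text \<open>Isomorphisms from \<open>G\<close> onto a subgraph of \<open>C\<close> with quotient
  \<open>B\<close> are counted twice. Choosing the subgraph first leaves \<open>aut2 G\<close> of
  them for each; choosing first the extension of \<open>G\<close> that results when the edges of
  \<open>C\<close> are pulled back leaves \<open>aut2 C\<close> isomorphisms from this extension to
  \<open>C\<close>.\<close>

lemma card_subgraphs_eq_card_extensions:
  assumes G: "wf2 G" and B: "wf2 B" and C: "wf2 C"
  shows "card {K \<in> subgraph_sets C. iso2 G (sub C K) \<and> iso2 B (contract C K)} * aut2 G =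
    card {(i, t) \<in> extensions G. iso2 B (rewire (residue G) i t) \<and> iso2 (rewire G i t) C} * aut2 C"
proof -
  define S where "S = {K \<in> subgraph_sets C. iso2 G (sub C K) \<and> iso2 B (contract C K)}"
  define E where "E = {(i, t) \<in> extensions G. iso2 B (rewire (residue G) i t) \<and> iso2 (rewire G i t) C}"
  let ?M = "\<lambda>K. iso2_maps G (sub C K)" and ?N = "\<lambda>e. iso2_maps (rewire G (fst e) (snd e)) C"
  have finS: "finite S"
  proof (rule finite_subset)
    show "S \<subseteq> Pow (gH C)" by (auto simp: S_def subgraph_sets_def edge_hes_def)
  qed (simp add: C)
  have finE: "finite E" using finite_extensions[OF G] by (rule rev_finite_subset) (auto simp: E_def)
  have wfE: "wf2 (rewire G (fst e) (snd e))" if "e \<in> E" for e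
    using that extensionsD(3) by (auto simp: E_def)
  have injS: "inj_on snd (Sigma S ?M)"
  proof (rule inj_onI)
    fix x y assume xy: "x \<in> Sigma S ?M" "y \<in> Sigma S ?M" "snd x = snd y"
    obtain K f k m where x: "x = (K, f, k, m)" by (metis prod.exhaust)
    obtain K' where y: "y = (K', f, k, m)" using xy(3) x by (metis prod.exhaust snd_conv)
    \<comment> \<open>The subgraph is determined by the isomorphism: the half-edges on its edges are
      the images of those of \<open>G\<close>.\<close>
    have "K = k ` edge_hes G" if "(K, f, k, m) \<in> Sigma S ?M" for K
      using edge_hes_image[OF G, of "sub C K" f k m] edge_hes_sub[OF C, of K] that
      by (auto simp: S_def iso2_maps_iff)
    then show "x = y" using xy x y by metis
  qed
  have injE: "inj_on snd (Sigma E ?N)"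
  proof (rule inj_onI)
    fix x y assume xy: "x \<in> Sigma E ?N" "y \<in> Sigma E ?N" "snd x = snd y"
    obtain i t f k m where x: "x = ((i, t), f, k, m)" by (metis prod.exhaust)
    obtain i' t' where y: "y = ((i', t'), f, k, m)" using xy(3) x by (metis prod.exhaust snd_conv)
    have e: "(i, t) \<in> extensions G" "(i', t') \<in> extensions G"
      and I: "iso_triple (rewire G i t) C f k m" "iso_triple (rewire G i' t') C f k m"
      using xy x y by (auto simp: iso2_maps_iff E_def)
    note D = iso_tripleD[OF I(1)] and D' = iso_tripleD[OF I(2)]
    have "i = i'"
    proof (rule extensionalityI[OF extensionsD(1)[OF e(1)] extensionsD(1)[OF e(2)]])
      fix h assume h: "h \<in> gH G"
      have "k (i h) = k (i' h)" using D(5)[of h] D'(5)[of h] h by simp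
      then show "i h = i' h"
        using D(2) extensionsD(6)[OF e(1) h] extensionsD(6)[OF e(2) h]
        by (auto simp: bij_betw_def dest: inj_onD)
    qed
    moreover have "t = t'"
    proof (rule extensionalityI[OF extensionsD(2)[OF e(1)] extensionsD(2)[OF e(2)]])
      fix s assume s: "s \<in> gS G"
      have "m (t s) = m (t' s)" using D(8)[of s] D'(8)[of s] s by simp
      then show "t s = t' s"
        using D(3) extensionsD(8)[OF e(1) s] extensionsD(8)[OF e(2) s]
        by (auto simp: bij_betw_def dest: inj_onD)
    qed
    ultimately show "x = y" by (simp add: x y)
  qed
  \<comment> \<open>The two families consist of the same triples \<open>(f, k, m)\<close>, only
    indexed by different data.\<close>
  have im: "snd ` Sigma S ?M = snd ` Sigma E ?N"
  proof (intro equalityI subsetI)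
    fix z assume "z \<in> snd ` Sigma S ?M"
    then obtain K where K: "K \<in> subgraph_sets C" "iso2 G (sub C K)" "iso2 B (contract C K)"
      and zin: "z \<in> ?M K" by (auto simp: S_def)
    obtain f k m where z: "z = (f, k, m)" by (metis prod.exhaust)
    have I: "iso_triple G (sub C K) f k m" using zin z by (simp add: iso2_maps_iff)
    note D = iso_tripleD[OF I] and wfs = wf2_sub[OF C K(1)]
    define i where "i = restrict (\<lambda>h. inv_into (gH G) k (giota C (k h))) (gH G)"
    define t where "t = restrict (\<lambda>s. inv_into (gS G) m (gs2 C (m s))) (gS G)"
    have imk: "k ` gH G = gH C" and imm: "m ` gS G = gS C" and injk: "inj_on k (gH G)" and injm: "inj_on m (gS G)"
      using D(2,3) by (simp_all add: bij_betw_def)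
    have giC: "giota C (k h) \<in> k ` gH G" if "h \<in> gH G" for h using that C D(10)[OF that] by (simp add: imk)
    have gsC: "gs2 C (m s) \<in> m ` gS G" if "s \<in> gS G" for s using that C D(11)[OF that] by (simp add: imm)
    have ki: "k (i h) = giota C (k h)" "i h \<in> gH G" if "h \<in> gH G" for h
      using that giC[OF that] by (simp_all add: i_def f_inv_into_f inv_into_into)
    have mt: "m (t s) = gs2 C (m s)" "t s \<in> gS G" if "s \<in> gS G" for s
      using that gsC[OF that] by (simp_all add: t_def f_inv_into_f inv_into_into)
    have I': "iso_triple (rewire G i t) C f k m"
      using I by (simp add: iso_triple_def ki mt)
    have wfr: "wf2 (rewire G i t)"
      by (rule wf2_pullback[OF C I']) (use G ki mt in simp_all)
    have "i h = giota G h" if h: "h \<in> gH G" "giota G h \<noteq> h" for h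
    proof -
      \<comment> \<open>A half-edge moved in the subgraph lies in \<open>K\<close>, where the
        subgraph has the involution of \<open>C\<close>; so the pulled-back wiring keeps the edges
        of \<open>G\<close>.\<close>
      have "k (giota G h) \<noteq> k h" using injk h G by (auto dest: inj_onD)
      then have "k (giota G h) = giota C (k h)" using D(5)[OF h(1)] by (auto split: if_splits)
      then have "k (i h) = k (giota G h)" using ki h by simp
      then show ?thesis using injk ki(2) h G by (auto dest: inj_onD)
    qed
    moreover have "t s = gs2 G s" if s: "s \<in> gS G" "gs2 G s \<noteq> s" for s
    proof -
      have "m (gs2 G s) \<noteq> m s" using injm s G by (auto dest: inj_onD)
      then have "m (gs2 G s) = gs2 C (m s)" using D(8)[OF s(1)] by (auto split: if_splits)
      then have "m (t s) = m (gs2 G s)" using mt s by simp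
      then show ?thesis using injm mt(2) s G by (auto dest: inj_onD)
    qed
    ultimately have e: "(i, t) \<in> extensions G" using wfr by (simp add: extensions_def i_def t_def)
    note X = extension_subgraph[OF G e] and wfx = wf2_rewire_residue[OF G e]
    have Ki: "K = k ` edge_hes G" using edge_hes_image[OF G I] edge_hes_sub[OF C K(1)] by simp
    have "iso2 (contract (rewire G i t) (edge_hes G)) (contract C K)"
      using subgraph_image(3)[OF wfr C I' X(1)] iso2_iff[OF wf2_contract[OF wfr X(1)]] Ki by blast
    moreover have "iso2 (rewire (residue G) i t) (contract (rewire G i t) (edge_hes G))"
      using X(3) iso2_iff[OF wfx] by blast
    ultimately have "iso2 B (rewire (residue G) i t)"
      using K(3) B wfx wf2_contract[OF C K(1)] wf2_contract[OF wfr X(1)] iso2_trans iso2_sym by meson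
    then have "(i, t) \<in> E" using e I' wfr iso2_iff by (auto simp: E_def)
    moreover have "z \<in> ?N (i, t)" using zin I' by (simp add: z iso2_maps_iff)
    ultimately have "((i, t), z) \<in> Sigma E ?N" by simp
    then show "z \<in> snd ` Sigma E ?N" by force
  next
    fix z assume "z \<in> snd ` Sigma E ?N"
    then obtain i t where e: "(i, t) \<in> extensions G" "iso2 B (rewire (residue G) i t)"
      and zin: "z \<in> iso2_maps (rewire G i t) C" by (auto simp: E_def)
    obtain f k m where z: "z = (f, k, m)" by (metis prod.exhaust)
    have I: "iso_triple (rewire G i t) C f k m" using zin z by (simp add: iso2_maps_iff)
    note X = extension_subgraph[OF G e(1)] and wfr = extensionsD(3)[OF e(1)]
    note Y = subgraph_image[OF wfr C I X(1)] and wfx = wf2_rewire_residue[OF G e(1)]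
    let ?K = "k ` edge_hes G"
    have J: "iso_triple G (sub C ?K) f k m" using iso_triple_trans[OF X(2) Y(2)] by simp
    have "iso2 (rewire (residue G) i t) (contract C ?K)"
      using iso_triple_trans[OF X(3) Y(3)] iso2_iff[OF wfx] by blast
    then have "iso2 B (contract C ?K)" using e(2) B wfx iso2_trans by blast
    then have "?K \<in> S" using J Y(1) iso2_iff[OF G] by (auto simp: S_def)
    moreover have "z \<in> ?M ?K" using zin J by (simp add: z iso2_maps_iff)
    ultimately have "(?K, z) \<in> Sigma S ?M" by simp
    then show "z \<in> snd ` Sigma S ?M" by force
  qed
  have "card (Sigma S ?M) = card (Sigma E ?N)"
    using card_image[OF injS] card_image[OF injE] unfolding im by simp
  moreover have "card (Sigma S ?M) = card S * aut2 G"
  proof -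
    have "card (Sigma S ?M) = (\<Sum>K\<in>S. card (?M K))"
      using finS G C by (intro card_SigmaI) (auto intro!: finite_iso2_maps)
    also have "\<dots> = (\<Sum>K\<in>S. aut2 G)"
      using card_iso2_maps_eq_aut2[OF G wf2_sub[OF C]] by (intro sum.cong) (auto simp: S_def)
    finally show ?thesis by simp
  qed
  moreover have "card (Sigma E ?N) = card E * aut2 C"
  proof -
    have "card (Sigma E ?N) = (\<Sum>e\<in>E. card (?N e))"
      using finE C wfE by (intro card_SigmaI) (auto intro!: finite_iso2_maps)
    also have "\<dots> = (\<Sum>e\<in>E. aut2 C)"
    proof (rule sum.cong)
      fix e assume e: "e \<in> E"
      then have "iso2 (rewire G (fst e) (snd e)) C" by (auto simp: E_def)
      then show "card (?N e) = aut2 C"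
        using card_iso2_maps_eq_aut2[OF wfE[OF e] C] aut2_cong[OF wfE[OF e] C] by simp
    qed simp
    finally show ?thesis by simp
  qed
  ultimately show ?thesis by (simp add: S_def E_def)
qed

text \<open>The factor \<open>1 / aut2 (rep2 c)\<close> in \<open>Xall\<close> cancels the
  automorphisms of \<open>C\<close> in the double count. What remains is, for each class, the number
  of extensions in it divided by \<open>aut2 G\<close>, and these classes partition a finite
  set.\<close>

lemma infsum_subgraphs:
  assumes G: "wf2 G" and B: "wf2 B"
  shows "(\<Sum>\<^sub>\<infinity>c\<in>U2. Xall c * real (delta_coeff (rep2 c) (cls2 G) (cls2 B))) =
    real (card (iso2_maps (bare B) (residue G))) / (real (aut2 G) * real (aut2 B))"
proof -
  define E where "E = {(i, t) \<in> extensions G. iso2 B (rewire (residue G) i t)}"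
  define q where "q = (\<lambda>e. cls2 (rewire G (fst e) (snd e)))"
  have finE: "finite E" using finite_extensions[OF G] by (rule rev_finite_subset) (auto simp: E_def)
  have wfE: "wf2 (rewire G (fst e) (snd e))" if "e \<in> E" for e
    using that extensionsD(3) by (auto simp: E_def)
  have pos: "real (aut2 G) \<noteq> 0" "real (aut2 B) \<noteq> 0" using aut2_pos G B by (metis less_numeral_extra(3) of_nat_eq_0_iff)+
  have coeff: "Xall c * real (delta_coeff (rep2 c) (cls2 G) (cls2 B)) = real (card {e \<in> E. q e = c}) / real (aut2 G)"
    if c: "c \<in> U2" for c
  proof -
    let ?C = "rep2 c"
    note C = rep2_props[OF c]
    have "{K \<in> subgraph_sets ?C. cls2 (sub ?C K) = cls2 G \<and> cls2 (contract ?C K) = cls2 B} =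
      {K \<in> subgraph_sets ?C. iso2 G (sub ?C K) \<and> iso2 B (contract ?C K)}"
      using cls2_eq_iff[OF G wf2_sub[OF C(1)]] cls2_eq_iff[OF B wf2_contract[OF C(1)]] by (auto simp: eq_commute)
    then have "delta_coeff ?C (cls2 G) (cls2 B) * aut2 G =
      card {(i, t) \<in> extensions G. iso2 B (rewire (residue G) i t) \<and> iso2 (rewire G i t) ?C} * aut2 ?C"
      using card_subgraphs_eq_card_extensions[OF G B C(1)] by (simp add: delta_coeff_def)
    also have "{(i, t) \<in> extensions G. iso2 B (rewire (residue G) i t) \<and> iso2 (rewire G i t) ?C} =
        {e \<in> E. iso2 (rewire G (fst e) (snd e)) ?C}" by (auto simp: E_def)
    also have "\<dots> = {e \<in> E. q e = c}"
    proof -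
      have "q e = c \<longleftrightarrow> iso2 (rewire G (fst e) (snd e)) ?C" if "e \<in> E" for e
        using cls2_eq_iff[OF wfE[OF that] C(1)] C(2) by (simp add: q_def)
      then show ?thesis by blast
    qed
    finally have "real (delta_coeff ?C (cls2 G) (cls2 B)) * real (aut2 G) = real (card {e \<in> E. q e = c}) * real (aut2 ?C)"
      by (simp flip: of_nat_mult)
    then show ?thesis using pos aut2_pos[OF C(1)] by (simp add: Xall_def field_simps)
  qed
  have "(\<Sum>\<^sub>\<infinity>c\<in>U2. Xall c * real (delta_coeff (rep2 c) (cls2 G) (cls2 B))) =
    (\<Sum>\<^sub>\<infinity>c\<in>q ` E. real (card {e \<in> E. q e = c}) / real (aut2 G))"
  proof (rule infsum_cong_neutral)
    fix c assume "c \<in> U2 - q ` E"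
    then have c: "c \<in> U2" and "{e \<in> E. q e = c} = {}" by auto
    then show "Xall c * real (delta_coeff (rep2 c) (cls2 G) (cls2 B)) = 0"
      unfolding coeff[OF c] by (simp only: card.empty of_nat_0 div_0)
  next
    fix c assume "c \<in> q ` E - U2"
    then show "real (card {e \<in> E. q e = c}) / real (aut2 G) = 0" using wfE by (auto simp: q_def)
  qed (simp add: coeff)
  also have "\<dots> = (\<Sum>c\<in>q ` E. real (card {e \<in> E. q e = c})) / real (aut2 G)"
    using finE by (simp add: sum_divide_distrib)
  also have "(\<Sum>c\<in>q ` E. real (card {e \<in> E. q e = c})) = real (card E)"
    using sum.image_gen[OF finE, of "\<lambda>_. 1::real" q] by simp
  also have "real (card E) = real (card (iso2_maps (bare B) (residue G))) / real (aut2 B)"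
    using arg_cong[OF card_extensions_contracting_to[OF G B], of real] pos by (simp add: E_def field_simps)
  finally show ?thesis by (simp add: field_simps)
qed

section \<open>Splitting off a component\<close>

text \<open>\<open>W\<close> may contain numbers that are not vertices, so that the part outside a
  component \<open>K\<close> is simply \<open>induced G (- K)\<close>.\<close>

definition induced :: "g2 \<Rightarrow> nat set \<Rightarrow> g2" where
  "induced G W = G\<lparr> gV := gV G \<inter> W, gH := {h \<in> gH G. gnu G h \<in> W},
     gS := {s \<in> gS G. gnu G (gmu G s) \<in> W} \<rparr>"

lemma induced_sel [simp]:
  "gV (induced G W) = gV G \<inter> W" "gH (induced G W) = {h \<in> gH G. gnu G h \<in> W}"
  "gS (induced G W) = {s \<in> gS G. gnu G (gmu G s) \<in> W}"
  "gnu (induced G W) = gnu G" "giota (induced G W) = giota G" "gmu (induced G W) = gmu G"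
  "gs1 (induced G W) = gs1 G" "gs2 (induced G W) = gs2 G"
  by (simp_all add: induced_def)

text \<open>No edge leaves \<open>W\<close>; on the vertices this makes \<open>W\<close> a union of
  components.\<close>

definition saturated :: "g2 \<Rightarrow> nat set \<Rightarrow> bool" where
  "saturated G W \<longleftrightarrow> (\<forall>h\<in>gH G. gnu G (giota G h) \<in> W \<longleftrightarrow> gnu G h \<in> W)"

lemma saturated_Compl: "saturated G W \<Longrightarrow> saturated G (- W)"
  by (simp add: saturated_def)

lemma wf2_induced:
  assumes G: "wf2 G" and W: "saturated G W"
  shows "wf2 (induced G W)"
proof -
  have 1: "gnu G (giota G h) \<in> W \<longleftrightarrow> gnu G h \<in> W" if "h \<in> gH G" for h
    using W that by (simp add: saturated_def)
  have "gnu G (gmu G (gs2 G s)) \<in> W \<longleftrightarrow> gnu G (gmu G s) \<in> W" if "s \<in> gS G" for s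
    using 1[of "gmu G s"] G that by simp
  then show ?thesis unfolding wf2_def using G 1 by simp
qed

lemma mem_comp_iff: "wf2 G \<Longrightarrow> w \<in> comp G v \<longleftrightarrow> comp G w = comp G v"
  using comp_eq comp_self by blast

lemma saturated_comp: "wf2 G \<Longrightarrow> saturated G (comp G v)"
  by (simp add: saturated_def mem_comp_iff comp_edge)

lemma comp_subset_saturated:
  assumes "saturated G W" "v \<in> W" shows "comp G v \<subseteq> W"
proof
  fix w assume "w \<in> comp G v"
  then have "(v, w) \<in> (adj G)\<^sup>*" by (simp add: comp_def)
  then show "w \<in> W"
    by induction (use assms in \<open>auto simp: adj_def saturated_def\<close>)
qed

text \<open>A path that starts in a saturated set stays in it, so no connection is lost by the
  restriction.\<close>

lemma comp_induced:
  assumes W: "saturated G W" and v: "v \<in> W"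
  shows "comp (induced G W) v = comp G v"
proof
  have "adj (induced G W) \<subseteq> adj G" by (auto simp: adj_def)
  then show "comp (induced G W) v \<subseteq> comp G v" unfolding comp_def using rtrancl_mono by blast
  show "comp G v \<subseteq> comp (induced G W) v"
  proof
    fix w assume "w \<in> comp G v"
    then have "(v, w) \<in> (adj G)\<^sup>*" by (simp add: comp_def)
    then have "(v, w) \<in> (adj (induced G W))\<^sup>*"
    proof induction
      case (step y z)
      have "y \<in> W" using comp_subset_saturated[OF W v] step.hyps by (auto simp: comp_def)
      then have "(y, z) \<in> adj (induced G W)" using step.hyps by (auto simp: adj_def)
      then show ?case using step.IH by simp
    qed simp
    then show "w \<in> comp (induced G W) v" by (simp add: comp_def)
  qed
qed

definition comps :: "g2 \<Rightarrow> nat set set" where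
  "comps G = comp G ` gV G"

lemma finite_comps: "wf2 G \<Longrightarrow> finite (comps G)"
  by (simp add: comps_def)

lemma saturated_comps: "wf2 G \<Longrightarrow> K \<in> comps G \<Longrightarrow> saturated G K"
  by (auto simp: comps_def saturated_comp)

lemma connected2_comps:
  assumes "wf2 G" "K \<in> comps G" shows "connected2 (induced G K)"
proof -
  obtain v where v: "v \<in> gV G" "K = comp G v" using assms by (auto simp: comps_def)
  have "comp (induced G K) w = gV G \<inter> K" if "w \<in> K" for w
    using comp_induced[OF saturated_comps[OF assms] that] that comp_subset[OF assms(1) v(1)]
    by (auto simp: v(2) mem_comp_iff[OF assms(1)])
  moreover have "gV G \<inter> K \<noteq> {}" using v by auto
  ultimately show ?thesis
    by (simp add: connected2_iff[OF wf2_induced[OF assms(1) saturated_comps[OF assms]]])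
qed

lemma iso_triple_induced:
  assumes "wf2 M" "iso_triple M A f k m" "\<And>v. v \<in> gV M \<Longrightarrow> v \<in> W \<longleftrightarrow> f v \<in> K"
  shows "iso_triple (induced M W) (induced A K) f k m"
proof -
  note D = iso_tripleD[OF assms(2)]
  have "bij_betw f {v \<in> gV M. v \<in> W} {v \<in> gV A. v \<in> K}"
    using D(1) assms(3) by (rule bij_betw_Collect)
  moreover have "bij_betw k {h \<in> gH M. gnu M h \<in> W} {h \<in> gH A. gnu A h \<in> K}"
    using D(2) by (rule bij_betw_Collect) (simp add: assms D(4)[symmetric])
  moreover have "bij_betw m {s \<in> gS M. gnu M (gmu M s) \<in> W} {s \<in> gS A. gnu A (gmu A s) \<in> K}"
    using D(3) by (rule bij_betw_Collect) (simp add: assms D(4,6)[symmetric])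
  ultimately show ?thesis using D unfolding iso_triple_def by (simp add: Int_def)
qed

lemma bij_betw_if:
  assumes "bij_betw f {x \<in> A. P x} {y \<in> B. Q y}" "bij_betw g {x \<in> A. \<not> P x} {y \<in> B. \<not> Q y}"
  shows "bij_betw (\<lambda>x. if P x then f x else g x) A B"
proof -
  have "bij_betw (\<lambda>x. if P x then f x else g x) ({x \<in> A. P x} \<union> {x \<in> A. \<not> P x}) ({y \<in> B. Q y} \<union> {y \<in> B. \<not> Q y})"
  proof (rule bij_betw_combine)
    show "bij_betw (\<lambda>x. if P x then f x else g x) {x \<in> A. P x} {y \<in> B. Q y}"
      using assms(1) by (subst bij_betw_cong[where g = f]) auto
    show "bij_betw (\<lambda>x. if P x then f x else g x) {x \<in> A. \<not> P x} {y \<in> B. \<not> Q y}"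
      using assms(2) by (subst bij_betw_cong[where g = g]) auto
  qed auto
  moreover have "{x \<in> A. P x} \<union> {x \<in> A. \<not> P x} = A" "{y \<in> B. Q y} \<union> {y \<in> B. \<not> Q y} = B" by auto
  ultimately show ?thesis by simp
qed

text \<open>Every structure map respects the two sides: edges because \<open>W\<close> is saturated,
  strand sections because \<open>gs1\<close> keeps the vertex and \<open>gs2\<close> follows an edge
  or does nothing. Hence a case distinction on the vertex commutes with all of them.\<close>

lemma iso_triple_glue:
  assumes M: "wf2 M" and W: "saturated M W"
    and 1: "iso_triple (induced M W) (induced A K) f1 k1 m1"
    and 2: "iso_triple (induced M (- W)) (induced A (- K)) f2 k2 m2"
  shows "iso_triple M A (\<lambda>v. if v \<in> W then f1 v else f2 v)
    (\<lambda>h. if gnu M h \<in> W then k1 h else k2 h) (\<lambda>s. if gnu M (gmu M s) \<in> W then m1 s else m2 s)"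
proof -
  note D1 = iso_tripleD[OF 1, simplified] and D2 = iso_tripleD[OF 2, simplified]
  have io: "gnu M (giota M h) \<in> W \<longleftrightarrow> gnu M h \<in> W" if "h \<in> gH M" for h
    using W that by (simp add: saturated_def)
  have s2: "gnu M (gmu M (gs2 M s)) \<in> W \<longleftrightarrow> gnu M (gmu M s) \<in> W" if "s \<in> gS M" for s
    using io[of "gmu M s"] M that by simp
  have "bij_betw (\<lambda>v. if v \<in> W then f1 v else f2 v) (gV M) (gV A)"
    by (rule bij_betw_if[where Q = "\<lambda>v. v \<in> K"]) (use D1(1) D2(1) in \<open>simp_all add: Int_def\<close>)
  moreover have "bij_betw (\<lambda>h. if gnu M h \<in> W then k1 h else k2 h) (gH M) (gH A)"
    by (rule bij_betw_if[where Q = "\<lambda>h. gnu A h \<in> K"]) (use D1(2) D2(2) in simp_all)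
  moreover have "bij_betw (\<lambda>s. if gnu M (gmu M s) \<in> W then m1 s else m2 s) (gS M) (gS A)"
    by (rule bij_betw_if[where Q = "\<lambda>s. gnu A (gmu A s) \<in> K"]) (use D1(3) D2(3) in simp_all)
  ultimately show ?thesis
    unfolding iso_triple_def using D1(4-8) D2(4-8) io s2 M by simp
qed

text \<open>An isomorphism maps the connected part onto a component \<open>K\<close>; for fixed \<open>K\<close> it is an
  arbitrary pair of isomorphisms of the two parts.\<close>

lemma card_iso2_maps_split:
  assumes M: "wf2 M" and A: "wf2 A" and W: "saturated M W" and con: "connected2 (induced M W)"
  shows "card (iso2_maps M A) = (\<Sum>K\<in>comps A. card (iso2_maps (induced M W) (induced A K)) *
    card (iso2_maps (induced M (- W)) (induced A (- K))))"
proof -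
  note W' = saturated_Compl[OF W]
  note wfM = wf2_induced[OF M W] wf2_induced[OF M W']
  define J where "J = (\<lambda>K. {(f, k, m) \<in> iso2_maps M A. \<forall>v\<in>gV M. v \<in> W \<longleftrightarrow> f v \<in> K})"
  \<comment> \<open>The image of a single vertex of the connected part decides which component
    \<open>K\<close> receives it.\<close>
  obtain v0 where v0: "v0 \<in> gV M" "v0 \<in> W" using con wfM(1) by (auto simp: connected2_iff)
  have comp0: "comp M v0 = gV M \<inter> W"
    using con v0 comp_induced[OF W v0(2)] by (simp add: connected2_iff[OF wfM(1)])
  have fin: "finite (iso2_maps M A)" using M A by (simp add: finite_iso2_maps)
  have disj: "K = K'" if K: "K \<in> comps A" "K' \<in> comps A" and x: "x \<in> J K" "x \<in> J K'" for K K' x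
  proof -
    obtain f k m where "x = (f, k, m)" by (metis prod.exhaust)
    then have "f v0 \<in> K" "f v0 \<in> K'" using x v0 by (auto simp: J_def)
    then show ?thesis using K mem_comp_iff[OF A] by (auto simp: comps_def)
  qed
  have cover: "x \<in> (\<Union>K\<in>comps A. J K)" if x: "x \<in> iso2_maps M A" for x
  proof -
    obtain f k m where fkm: "x = (f, k, m)" by (metis prod.exhaust)
    have I: "iso_triple M A f k m" using x fkm by (simp add: iso2_maps_iff)
    note D = iso_tripleD[OF I]
    \<comment> \<open>Connectedness makes the part in \<open>W\<close> the whole component of
      \<open>v0\<close>, so its image is a component of \<open>A\<close>.\<close>
    have "comp A (f v0) = f ` (gV M \<inter> W)" using comp_image[OF M A I v0(1)] comp0 by simp
    then have "v \<in> W \<longleftrightarrow> f v \<in> comp A (f v0)" if "v \<in> gV M" for v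
      using that D(1) by (auto simp: bij_betw_def dest: inj_onD)
    then have "x \<in> J (comp A (f v0))" using x fkm by (simp add: J_def)
    moreover have "comp A (f v0) \<in> comps A" using D(9) v0(1) by (simp add: comps_def)
    ultimately show ?thesis by blast
  qed
  have cardJ: "card (J K) = card (iso2_maps (induced M W) (induced A K)) *
      card (iso2_maps (induced M (- W)) (induced A (- K)))" for K
  proof -
    let ?r = "\<lambda>N (f, k, m). (restrict f (gV N), restrict k (gH N), restrict m (gS N))"
    let ?\<Phi> = "\<lambda>x. (?r (induced M W) x, ?r (induced M (- W)) x)"
    let ?X = "iso2_maps (induced M W) (induced A K)" and ?Y = "iso2_maps (induced M (- W)) (induced A (- K))"
    have "bij_betw ?\<Phi> (J K) (?X \<times> ?Y)"
      unfolding bij_betw_def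
    proof
      show "inj_on ?\<Phi> (J K)"
      proof (rule inj_onI)
        fix x y assume xy: "x \<in> J K" "y \<in> J K" "?\<Phi> x = ?\<Phi> y"
        obtain f k m f' k' m' where x: "x = (f, k, m)" and y: "y = (f', k', m')" by (metis prod.exhaust)
        have e: "f \<in> extensional (gV M)" "k \<in> extensional (gH M)" "m \<in> extensional (gS M)"
          "f' \<in> extensional (gV M)" "k' \<in> extensional (gH M)" "m' \<in> extensional (gS M)"
          using xy by (auto simp: x y J_def iso2_maps_iff)
        have glue: "g = g'" if eq: "restrict g B = restrict g' B" "restrict g C = restrict g' C"
          and D: "D \<subseteq> B \<union> C" and ext: "g \<in> extensional D" "g' \<in> extensional D" for g g' :: "nat \<Rightarrow> nat" and B C D
        proof (rule extensionalityI[OF ext])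
          fix z assume "z \<in> D"
          then consider "z \<in> B" | "z \<in> C" using D by blast
          then show "g z = g' z"
            by cases (use fun_cong[OF eq(1), of z] fun_cong[OF eq(2), of z] in simp_all)
        qed
        have "f = f'" by (rule glue[of _ "gV (induced M W)" _ "gV (induced M (- W))" "gV M"])
            (use xy(3) e in \<open>auto simp: x y\<close>)
        moreover have "k = k'" by (rule glue[of _ "gH (induced M W)" _ "gH (induced M (- W))" "gH M"])
            (use xy(3) e in \<open>auto simp: x y\<close>)
        moreover have "m = m'" by (rule glue[of _ "gS (induced M W)" _ "gS (induced M (- W))" "gS M"])
            (use xy(3) e in \<open>auto simp: x y\<close>)
        ultimately show "x = y" by (simp add: x y)
      qed
      show "?\<Phi> ` J K = ?X \<times> ?Y"
      proof (intro equalityI subsetI)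
        fix z assume "z \<in> ?\<Phi> ` J K"
        then obtain x where x: "x \<in> J K" "z = ?\<Phi> x" by blast
        obtain f k m where fkm: "x = (f, k, m)" by (metis prod.exhaust)
        have I: "iso_triple M A f k m" and v: "\<And>v. v \<in> gV M \<Longrightarrow> v \<in> W \<longleftrightarrow> f v \<in> K"
          using x fkm by (auto simp: J_def iso2_maps_iff)
        have "iso_triple (induced M W) (induced A K) f k m" "iso_triple (induced M (- W)) (induced A (- K)) f k m"
          by (rule iso_triple_induced[OF M I]; use v in simp)+
        then show "z \<in> ?X \<times> ?Y"
          unfolding x(2) fkm case_prod_conv
          by (intro SigmaI iso_triple_restrict[OF wfM(1)] iso_triple_restrict[OF wfM(2)])
      next
        fix z assume z: "z \<in> ?X \<times> ?Y"
        obtain f1 k1 m1 f2 k2 m2 where zz: "z = ((f1, k1, m1), (f2, k2, m2))" by (metis prod.exhaust)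
        have e: "f1 \<in> extensional (gV (induced M W))" "k1 \<in> extensional (gH (induced M W))"
          "m1 \<in> extensional (gS (induced M W))" "f2 \<in> extensional (gV (induced M (- W)))"
          "k2 \<in> extensional (gH (induced M (- W)))" "m2 \<in> extensional (gS (induced M (- W)))"
          and I: "iso_triple (induced M W) (induced A K) f1 k1 m1"
          "iso_triple (induced M (- W)) (induced A (- K)) f2 k2 m2"
          using z by (simp_all add: zz iso2_maps_iff)
        let ?f = "\<lambda>v. if v \<in> W then f1 v else f2 v"
        let ?k = "\<lambda>h. if gnu M h \<in> W then k1 h else k2 h"
        let ?m = "\<lambda>s. if gnu M (gmu M s) \<in> W then m1 s else m2 s"
        let ?x = "(restrict ?f (gV M), restrict ?k (gH M), restrict ?m (gS M))"
        have "?x \<in> iso2_maps M A"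
          using iso_triple_restrict[OF M iso_triple_glue[OF M W I]] .
        moreover have "v \<in> W \<longleftrightarrow> ?f v \<in> K" if "v \<in> gV M" for v
          using that iso_tripleD(9)[OF I(1), of v] iso_tripleD(9)[OF I(2), of v] by auto
        ultimately have "?x \<in> J K" by (simp add: J_def)
        moreover have "?\<Phi> ?x = z"
          using e unfolding zz by (auto simp: fun_eq_iff extensional_def restrict_def)
        ultimately show "z \<in> ?\<Phi> ` J K" by blast
      qed
    qed
    from bij_betw_same_card[OF this] show ?thesis by (simp only: card_cartesian_product)
  qed
  have "iso2_maps M A = (\<Union>K\<in>comps A. J K)" using cover by (auto simp: J_def)
  moreover have "card (\<Union>K\<in>comps A. J K) = (\<Sum>K\<in>comps A. card (J K))"
  proof (rule card_UN_disjoint[OF finite_comps[OF A]])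
    show "\<forall>K\<in>comps A. finite (J K)"
      by (intro ballI finite_subset[OF _ fin]) (auto simp: J_def)
    show "\<forall>K\<in>comps A. \<forall>K'\<in>comps A. K \<noteq> K' \<longrightarrow> J K \<inter> J K' = {}"
      using disj by blast
  qed
  ultimately show ?thesis by (simp add: cardJ)
qed

section \<open>Products of series\<close>

lemma dunion_sel:
  "gV (dunion G G') = dset (gV G) (gV G')" "gH (dunion G G') = dset (gH G) (gH G')"
  "gS (dunion G G') = dset (gS G) (gS G')" "gnu (dunion G G') = lift2 (gnu G) (gnu G')"
  "giota (dunion G G') = lift2 (giota G) (giota G')" "gmu (dunion G G') = lift2 (gmu G) (gmu G')"
  "gs1 (dunion G G') = lift2 (gs1 G) (gs1 G')" "gs2 (dunion G G') = lift2 (gs2 G) (gs2 G')"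
  by (simp_all add: dunion_def)

lemma lift2_simps [simp]: "lift2 f g (2 * x) = 2 * f x" "lift2 f g (Suc (2 * x)) = Suc (2 * g x)"
  by (simp_all add: lift2_def)

lemma dset_simps [simp]: "2 * x \<in> dset A B \<longleftrightarrow> x \<in> A" "Suc (2 * x) \<in> dset A B \<longleftrightarrow> x \<in> B"
  by (auto simp: dset_def) presburger+

lemma ball_dset: "(\<forall>x\<in>dset A B. P x) \<longleftrightarrow> (\<forall>x\<in>A. P (2 * x)) \<and> (\<forall>x\<in>B. P (Suc (2 * x)))"
  by (auto simp: dset_def)

lemma wf2_dunion: "wf2 P \<Longrightarrow> wf2 Q \<Longrightarrow> wf2 (dunion P Q)"
  unfolding wf2_def dunion_sel ball_dset lift2_simps dset_simps
  by (simp add: dset_def)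

text \<open>The summands of \<open>dunion\<close> are told apart by parity: even labels come from
  \<open>P\<close>, odd ones from \<open>Q\<close>, and no edge joins the two.\<close>

lemma saturated_dunion: "saturated (dunion P Q) {x. even x}"
  unfolding saturated_def dunion_sel ball_dset lift2_simps by simp

lemma iso_triple_dunion_left:
  "iso_triple P (induced (dunion P Q) {x. even x}) ((*) 2) ((*) 2) ((*) 2)"
proof -
  have "dset A B \<inter> {x. even x} = (*) 2 ` A" for A B by (auto simp: dset_def)
  moreover have "{x \<in> dset A B. even (lift2 f g x)} = (*) 2 ` A" for A B f g
    by (auto simp: dset_def)
  moreover have "{x \<in> dset A B. even (lift2 f g (lift2 f' g' x))} = (*) 2 ` A" for A B f g f' g'
    by (auto simp: dset_def)
  moreover have "bij_betw ((*) 2) A ((*) 2 ` A)" for A :: "nat set"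
    by (simp add: bij_betw_def inj_on_def)
  ultimately show ?thesis by (simp add: iso_triple_def dunion_sel)
qed

lemma iso_triple_dunion_right:
  "iso_triple Q (induced (dunion P Q) (- {x. even x}))
     (\<lambda>x. Suc (2 * x)) (\<lambda>x. Suc (2 * x)) (\<lambda>x. Suc (2 * x))"
proof -
  have "dset A B \<inter> (- {x. even x}) = (\<lambda>x. Suc (2 * x)) ` B" for A B by (auto simp: dset_def)
  moreover have "{x \<in> dset A B. odd (lift2 f g x)} = (\<lambda>x. Suc (2 * x)) ` B" for A B f g
    by (auto simp: dset_def)
  moreover have "{x \<in> dset A B. odd (lift2 f g (lift2 f' g' x))} = (\<lambda>x. Suc (2 * x)) ` B" for A B f g f' g'
    by (auto simp: dset_def)
  moreover have "bij_betw (\<lambda>x. Suc (2 * x)) A ((\<lambda>x. Suc (2 * x)) ` A)" for A :: "nat set"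
    by (simp add: bij_betw_def inj_on_def)
  ultimately show ?thesis by (simp add: iso_triple_def dunion_sel)
qed

lemma card_iso2_maps_dunion:
  assumes P: "wf2 P" and Q: "wf2 Q" and A: "wf2 A" and con: "connected2 P"
  shows "card (iso2_maps (dunion P Q) A) =
    (\<Sum>K\<in>comps A. card (iso2_maps P (induced A K)) * card (iso2_maps Q (induced A (- K))))"
proof -
  let ?D = "dunion P Q" and ?W = "{x :: nat. even x}"
  note W = saturated_dunion[of P Q]
  note D = wf2_dunion[OF P Q]
  note wf = wf2_induced[OF D W] wf2_induced[OF D saturated_Compl[OF W]]
  have i: "iso2 P (induced ?D ?W)" "iso2 Q (induced ?D (- ?W))"
    using iso_triple_dunion_left iso_triple_dunion_right P Q iso2_iff by blast+
  have "card (iso2_maps ?D A) = (\<Sum>K\<in>comps A. card (iso2_maps (induced ?D ?W) (induced A K)) *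
      card (iso2_maps (induced ?D (- ?W)) (induced A (- K))))"
    by (rule card_iso2_maps_split[OF D A W connected2_iso[OF P wf(1) i(1) con]])
  also have "\<dots> = (\<Sum>K\<in>comps A. card (iso2_maps P (induced A K)) * card (iso2_maps Q (induced A (- K))))"
  proof (rule sum.cong)
    fix K assume K: "K \<in> comps A"
    note s = saturated_comps[OF A K]
    show "card (iso2_maps (induced ?D ?W) (induced A K)) * card (iso2_maps (induced ?D (- ?W)) (induced A (- K))) =
      card (iso2_maps P (induced A K)) * card (iso2_maps Q (induced A (- K)))"
      using card_iso2_maps_source[OF wf2_induced[OF A s] P wf(1) i(1)]
        card_iso2_maps_source[OF wf2_induced[OF A saturated_Compl[OF s]] Q wf(2) i(2)] by simp
  qed simp
  finally show ?thesis .
qed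

section \<open>Residues of components\<close>

text \<open>Components and faces inside \<open>W\<close> do not see the rest of the graph, so taking
  the residue commutes with cutting out the part. \<open>W'\<close> selects the labels of the
  components in \<open>W\<close>; the maps are \<open>id\<close> since these labels are
  unchanged.\<close>

lemma iso_triple_residue_induced:
  assumes A: "wf2 A" and W: "saturated A W"
    and W': "\<And>v. v \<in> gV A \<Longrightarrow> v \<in> W \<longleftrightarrow> min_label A v \<in> W'"
  shows "iso_triple (residue (induced A W)) (induced (residue A) W') id id id"
proof -
  have ml: "min_label (induced A W) v = min_label A v" if "v \<in> W" for v
    using comp_induced[OF W that] by (simp add: min_label_def)
  have "min_label (induced A W) ` (gV A \<inter> W) = min_label A ` gV A \<inter> W'"
    using W' ml by (auto simp: image_iff)
  moreover have "{h \<in> gH A. gnu A h \<in> W \<and> giota A h = h} = {h \<in> gH A. giota A h = h \<and> min_label A (gnu A h) \<in> W'}"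
    using W' A by auto
  moreover have "{s \<in> gS A. gnu A (gmu A s) \<in> W \<and> gs2 A s = s} =
      {s \<in> gS A. gs2 A s = s \<and> min_label A (gnu A (gmu A s)) \<in> W'}"
    using W' A by auto
  moreover have "face_end (induced A W) s = face_end A s" for s
    by (simp add: face_end_def)
  moreover have "min_label (induced A W) (gnu A h) = min_label A (gnu A h)"
    if "h \<in> gH A" "min_label A (gnu A h) \<in> W'" for h
    using that ml W' A by simp
  ultimately show ?thesis
    by (simp add: iso_triple_def)
qed

lemma induced_induced: "induced (induced G X) Y = induced G (X \<inter> Y)"
  by (simp add: induced_def Int_assoc conj_assoc)

text \<open>The splitting formula for the skeleton with the vertex \<open>v\<close> as its connected
  part. Without edges every vertex of \<open>residue A\<close> is a component by itself, and these
  vertices stand for the components of \<open>A\<close>, so the sum runs over the same index set as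
  the one for disjoint unions.\<close>

lemma card_iso2_maps_bare_insert:
  assumes B: "wf2 B" and A: "wf2 A" and v: "v \<in> gV B" "v \<notin> X"
  shows "card (iso2_maps (induced (bare B) (insert v X)) (residue A)) =
    (\<Sum>K\<in>comps A. card (iso2_maps (induced (bare B) {v}) (residue (induced A K))) *
      card (iso2_maps (induced (bare B) X) (residue (induced A (- K)))))"
proof -
  let ?M = "induced (bare B) (insert v X)" and ?R = "residue A"
  have sat: "saturated (bare B) Y" for Y by (simp add: saturated_def bare_def)
  note wfB = wf2_induced[OF wf2_bare[OF B] sat]
  have R: "wf2 ?R" using A by (rule wf2_residue)
  have W: "saturated ?M {v}" by (simp add: saturated_def bare_def)
  have M1: "induced ?M {v} = induced (bare B) {v}" "induced ?M (- {v}) = induced (bare B) X"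
  proof -
    have "insert v X \<inter> {v} = {v}" "insert v X \<inter> - {v} = X" using v(2) by auto
    then show "induced ?M {v} = induced (bare B) {v}" "induced ?M (- {v}) = induced (bare B) X"
      by (simp_all only: induced_induced)
  qed
  have "connected2 (induced ?M {v})"
    using v(1) by (simp add: connected2_def M1 bare_def)
  note split = card_iso2_maps_split[OF wfB R W this, unfolded M1]
  \<comment> \<open>In the residue all half-edges are external, so adjacency never leads to another
    vertex.\<close>
  have "w = x" if "(x, w) \<in> (adj ?R)\<^sup>*" for x w
    using that by induction (auto simp: adj_def)
  then have "comp ?R x = {x}" for x by (auto simp: comp_def)
  then have comps_R: "comps ?R = (\<lambda>x. {x}) ` min_label A ` gV A"
    unfolding comps_def by simp
  have comps_A: "comps A = comp A ` min_label A ` gV A"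
    using comp_min_label[OF A] by (auto simp: comps_def image_iff)
  have inj: "inj_on (comp A) (min_label A ` gV A)"
    using comp_min_label[OF A] by (auto simp: inj_on_def min_label_def)
  have "card (iso2_maps ?M ?R) = (\<Sum>x\<in>min_label A ` gV A.
      card (iso2_maps (induced (bare B) {v}) (induced ?R {x})) *
      card (iso2_maps (induced (bare B) X) (induced ?R (- {x}))))"
    unfolding split comps_R by (subst sum.reindex) (auto simp: inj_on_def)
  also have "\<dots> = (\<Sum>x\<in>min_label A ` gV A.
      card (iso2_maps (induced (bare B) {v}) (residue (induced A (comp A x)))) *
      card (iso2_maps (induced (bare B) X) (residue (induced A (- comp A x)))))"
  proof (rule sum.cong)
    fix x assume x: "x \<in> min_label A ` gV A"
    have mem: "w \<in> comp A x \<longleftrightarrow> min_label A w = x" if "w \<in> gV A" for w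
      using x that comp_min_label[OF A] min_label_eq_iff[OF A] by (auto simp: mem_comp_iff[OF A])
    note s = saturated_comp[OF A, of x] and s' = saturated_Compl[OF saturated_comp[OF A, of x]]
    have sR: "saturated ?R Y" for Y by (simp add: saturated_def)
    note wf = wf2_residue[OF wf2_induced[OF A s]] wf2_residue[OF wf2_induced[OF A s']]
      wf2_induced[OF R sR]
    have "iso2 (residue (induced A (comp A x))) (induced ?R {x})"
      using iso_triple_residue_induced[OF A s, of "{x}"] mem iso2_iff[OF wf(1)] by auto
    moreover have "iso2 (residue (induced A (- comp A x))) (induced ?R (- {x}))"
      using iso_triple_residue_induced[OF A s', of "- {x}"] mem iso2_iff[OF wf(2)] by auto
    ultimately show "card (iso2_maps (induced (bare B) {v}) (induced ?R {x})) *
        card (iso2_maps (induced (bare B) X) (induced ?R (- {x}))) =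
      card (iso2_maps (induced (bare B) {v}) (residue (induced A (comp A x)))) *
        card (iso2_maps (induced (bare B) X) (residue (induced A (- comp A x))))"
      using card_iso2_maps_target[OF wfB wf(1,3)] card_iso2_maps_target[OF wfB wf(2,3)] by simp
  qed simp
  also have "\<dots> = (\<Sum>K\<in>comps A. card (iso2_maps (induced (bare B) {v}) (residue (induced A K))) *
      card (iso2_maps (induced (bare B) X) (residue (induced A (- K)))))"
    unfolding comps_A by (subst sum.reindex[OF inj]) simp
  finally show ?thesis .
qed

section \<open>Vertex graphs and boundaries\<close>

text \<open>With a single vertex the vertex map is forced, and without edges the conditions on
  \<open>giota\<close> and \<open>gs2\<close> hold by themselves. The remaining pair
  \<open>(k, m)\<close> is an isomorphism of vertex graphs, in which half-edges act as vertices and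
  strand sections as half-edges.\<close>

lemma bij_betw_iso1_maps_vgraph:
  assumes G: "wf2 G" "gV G = {x}" "\<And>h. h \<in> gH G \<Longrightarrow> giota G h = h" "\<And>s. s \<in> gS G \<Longrightarrow> gs2 G s = s"
    and G': "wf2 G'" "gV G' = {y}" "\<And>h. h \<in> gH G' \<Longrightarrow> giota G' h = h" "\<And>s. s \<in> gS G' \<Longrightarrow> gs2 G' s = s"
  shows "bij_betw snd (iso2_maps G G') (iso1_maps (vgraph G x) (vgraph G' y))"
proof -
  have nu: "gnu G h = x" if "h \<in> gH G" for h using wf2_simps(4)[OF G(1) that] G(2) by simp
  have nu': "gnu G' h = y" if "h \<in> gH G'" for h using wf2_simps(4)[OF G'(1) that] G'(2) by simp
  have [simp]: "V1 (vgraph G x) = gH G" "H1 (vgraph G x) = gS G" "nu1 (vgraph G x) = gmu G"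
    "iota1 (vgraph G x) = gs1 G" "V1 (vgraph G' y) = gH G'" "H1 (vgraph G' y) = gS G'"
    "nu1 (vgraph G' y) = gmu G'" "iota1 (vgraph G' y) = gs1 G'"
    using nu nu' G(1) G'(1) by (auto simp: vgraph_def)
  let ?f = "restrict (\<lambda>_. y) {x}"
  have f: "f = ?f" if "bij_betw f {x} {y}" "f \<in> extensional {x}" for f
    using that by (intro extensionalityI[OF that(2)]) (auto simp: bij_betw_def)
  have iff: "(f, k, m) \<in> iso2_maps G G' \<longleftrightarrow> f = ?f \<and> (k, m) \<in> iso1_maps (vgraph G x) (vgraph G' y)" for f k m
  proof
    assume a: "(f, k, m) \<in> iso2_maps G G'"
    then have "f = ?f" using f G(2) G'(2) by (simp add: iso2_maps_def)
    then show "f = ?f \<and> (k, m) \<in> iso1_maps (vgraph G x) (vgraph G' y)"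
      using a by (simp add: iso2_maps_def iso1_maps_def)
  next
    assume a: "f = ?f \<and> (k, m) \<in> iso1_maps (vgraph G x) (vgraph G' y)"
    then have km: "\<And>h. h \<in> gH G \<Longrightarrow> k h \<in> gH G'" "\<And>s. s \<in> gS G \<Longrightarrow> m s \<in> gS G'"
      by (auto simp: iso1_maps_def dest: bij_betwE)
    show "(f, k, m) \<in> iso2_maps G G'"
      using a km nu nu' G(2-4) G'(2-4) by (simp add: iso2_maps_def iso1_maps_def bij_betw_def)
  qed
  show ?thesis unfolding bij_betw_def
  proof
    show "inj_on snd (iso2_maps G G')" using iff by (auto simp: inj_on_def)
    show "snd ` iso2_maps G G' = iso1_maps (vgraph G x) (vgraph G' y)"
    proof (intro equalityI subsetI)
      fix z assume "z \<in> iso1_maps (vgraph G x) (vgraph G' y)"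
      then have "(?f, z) \<in> iso2_maps G G'" using iff[of ?f "fst z" "snd z"] by simp
      then show "z \<in> snd ` iso2_maps G G'" by force
    qed (use iff in auto)
  qed
qed

text \<open>The subgraph with all edges is the graph itself; this identifies
  \<open>residue P\<close> with the contraction from which \<open>boundary\<close> is read
  off.\<close>

lemma residue_iso_contract_all:
  assumes "wf2 P"
  shows "iso2 (residue P) (contract P (edge_hes P))"
proof -
  let ?H = "sub P (edge_hes P)"
  note K = edge_hes_in_subgraph_sets[OF assms]
  have "gmu P s \<in> edge_hes P \<longleftrightarrow> gs2 P s \<noteq> s" if "s \<in> gS P" for s
    using that assms by (simp add: edge_hes_def)
  then have "iso_triple P ?H id id id" by (auto simp: iso_triple_def edge_hes_def)
  then have "iso_triple (residue P) (residue ?H) (\<lambda>x. min_label ?H (id x)) id id"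
    by (rule iso_triple_residue[OF assms wf2_sub[OF assms K]])
  then have "iso_triple (rewire (residue P) (giota P) (gs2 P)) (contract P (edge_hes P)) (\<lambda>x. min_label ?H (id x)) id id"
    unfolding contract_eq by (rule iso_triple_rewire) simp_all
  moreover have "rewire (residue P) (giota P) (gs2 P) = residue P" by (simp add: rewire_def residue_def)
  ultimately show ?thesis using iso2_iff[OF wf2_residue[OF assms]] by metis
qed

text \<open>For connected \<open>rep2 c\<close> both its residue and the part of the skeleton at
  \<open>v\<close> have one vertex and no edges, with vertex graphs isomorphic to the boundary and
  to \<open>vgraph B v\<close>. Thus \<open>aut1\<close> times the indicator of an isomorphic
  boundary is a number of isomorphisms of 2-graphs.\<close>

lemma aut1_Xbd:
  assumes B: "wf2 B" "v \<in> gV B" and c: "c \<in> U2"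
  shows "real (aut1 (vgraph B v)) * Xbd (vgraph B v) c =
    (if connected2 (rep2 c) then real (card (iso2_maps (induced (bare B) {v}) (residue (rep2 c)))) / real (aut2 (rep2 c)) else 0)"
proof (cases "connected2 (rep2 c)")
  case True
  let ?P = "rep2 c" and ?G = "induced (bare B) {v}"
  let ?Q = "contract ?P (edge_hes ?P)"
  have P: "wf2 ?P" using rep2_props[OF c] by simp
  note K = edge_hes_in_subgraph_sets[OF P]
  have Q: "wf2 ?Q" using wf2_contract[OF P K] .
  have R: "wf2 (residue ?P)" using wf2_residue[OF P] .
  have G: "wf2 ?G" by (rule wf2_induced[OF wf2_bare[OF B(1)]]) (simp add: saturated_def bare_def)
  have GV: "gV ?G = {v}" using B(2) by (simp add: bare_def)
  have Gid: "giota ?G h = h" "gs2 ?G h = h" for h by (simp_all add: bare_def)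
  have vg: "vgraph ?G v = vgraph B v" by (auto simp: vgraph_def bare_def)
  have RQ: "iso2 (residue ?P) ?Q" using residue_iso_contract_all[OF P] .
  obtain f k m where I: "iso_triple (residue ?P) ?Q f k m" using RQ iso2_iff[OF R] by blast
  obtain p where p: "p \<in> gV ?P" using True by (auto simp: connected2_def)
  have "min_label ?P w = Min (gV ?P)" if "w \<in> gV ?P" for w
    using True that by (simp add: connected2_iff[OF P] min_label_def)
  then have "gV (residue ?P) = {Min (gV ?P)}" using p by auto
  then have QV: "gV ?Q = {f (Min (gV ?P))}" using iso_tripleD(1)[OF I] by (simp add: bij_betw_def)
  define y where "y = f (Min (gV ?P))"
  have Qid: "giota ?Q h = h" if "h \<in> gH ?Q" for h
    using that unfolding contract_fixed[OF P K] by (simp add: edge_hes_def contract_eq)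
  have Qid2: "gs2 ?Q s = s" if "s \<in> gS ?Q" for s
    using that P wf2_simps(7)[OF P, of s] unfolding contract_fixed[OF P K]
    by (auto simp: edge_hes_def contract_eq)
  have bd: "boundary ?P = vgraph ?Q y" by (simp add: boundary_def QV y_def)
  have "iso1 (boundary ?P) (vgraph B v) \<longleftrightarrow> iso2 ?Q ?G"
    using bij_betw_iso1_maps_vgraph[OF Q QV[folded y_def] Qid Qid2 G GV Gid]
    unfolding iso1_def iso2_def bd vg by (auto simp: bij_betw_def)
  also have "\<dots> \<longleftrightarrow> iso2 ?G (residue ?P)"
    using RQ R Q G iso2_trans iso2_sym by meson
  finally have 1: "iso1 (boundary ?P) (vgraph B v) \<longleftrightarrow> iso2 ?G (residue ?P)" .
  have "aut1 (vgraph B v) = aut2 ?G"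
    using bij_betw_same_card[OF bij_betw_iso1_maps_vgraph[OF G GV Gid G GV Gid]]
    by (simp add: aut1_def aut2_def vg)
  then show ?thesis
    using True card_iso2_maps_eq_aut2[OF G R] by (simp add: Xbd_def 1)
qed (simp add: Xbd_def)

section \<open>The coefficients of the product over the vertices\<close>

lemma card_iso2_maps_empty:
  assumes G: "wf2 G" "gV G = {}" and G': "wf2 G'"
  shows "card (iso2_maps G G') = (if gV G' = {} then 1 else 0)"
proof -
  have e: "gH X = {}" "gS X = {}" if "wf2 X" "gV X = {}" for X
    using wf2_simps(4,7)[OF that(1)] that(2) by blast+
  show ?thesis
  proof (cases "gV G' = {}")
    case True
    have "iso2_maps G G' = {(\<lambda>_. undefined, \<lambda>_. undefined, \<lambda>_. undefined)}"
      using e[OF G] e[OF G' True] G(2) True by (auto simp: iso2_maps_def bij_betw_def)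
    then show ?thesis using True by simp
  next
    case False
    then have "iso2_maps G G' = {}" using G(2) by (auto simp: iso2_maps_def bij_betw_def)
    then show ?thesis using False by simp
  qed
qed

lemma wf2_empty2: "wf2 empty2"
  by (simp add: wf2_def empty2_def)

lemma sone_cls2:
  assumes "wf2 A"
  shows "sone (cls2 A) = (if gV A = {} then 1 else 0)"
proof -
  have V: "gV empty2 = {}" by (simp add: empty2_def)
  have "iso2 empty2 A \<longleftrightarrow> card (iso2_maps empty2 A) \<noteq> 0"
    using finite_iso2_maps[of empty2 A] assms wf2_empty2 by (simp add: iso2_def)
  then show ?thesis
    using card_iso2_maps_empty[OF wf2_empty2 V assms] cls2_eq_iff[OF wf2_empty2 assms]
    by (cases "gV A = {}") (simp_all add: sone_def eq_commute[of "cls2 A"])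
qed

text \<open>The pair of classes by which the component \<open>K\<close> contributes to the product
  of two series.\<close>

definition split_classes :: "g2 \<Rightarrow> nat set \<Rightarrow> g2 set \<times> g2 set" where
  "split_classes A K = (cls2 (induced A K), cls2 (induced A (- K)))"

text \<open>Each component of \<open>A\<close> whose split has type \<open>(p, q)\<close>
  contributes all pairs of isomorphisms onto its two parts, any other component none. When
  \<open>A\<close> is itself the disjoint union, this expresses \<open>aut2 A\<close> through the
  automorphisms of the parts.\<close>

lemma card_iso2_maps_dunion_reps:
  assumes A: "wf2 A" and p: "p \<in> U2" and q: "q \<in> U2" and con: "connected2 (rep2 p)"
  shows "card (iso2_maps (dunion (rep2 p) (rep2 q)) A) =
    card {K \<in> comps A. split_classes A K = (p, q)} * (aut2 (rep2 p) * aut2 (rep2 q))"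
proof -
  note P = rep2_props[OF p] and Q = rep2_props[OF q]
  have "card (iso2_maps (dunion (rep2 p) (rep2 q)) A) =
    (\<Sum>K\<in>comps A. card (iso2_maps (rep2 p) (induced A K)) * card (iso2_maps (rep2 q) (induced A (- K))))"
    by (rule card_iso2_maps_dunion[OF P(1) Q(1) A con])
  also have "\<dots> = (\<Sum>K\<in>comps A. if split_classes A K = (p, q) then aut2 (rep2 p) * aut2 (rep2 q) else 0)"
  proof (rule sum.cong)
    fix K assume "K \<in> comps A"
    note s = saturated_comps[OF A this]
    note wf = wf2_induced[OF A s] wf2_induced[OF A saturated_Compl[OF s]]
    have "cls2 (induced A K) = p \<longleftrightarrow> iso2 (rep2 p) (induced A K)"
      "cls2 (induced A (- K)) = q \<longleftrightarrow> iso2 (rep2 q) (induced A (- K))"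
      using cls2_eq_iff[OF P(1) wf(1)] cls2_eq_iff[OF Q(1) wf(2)] unfolding P(2) Q(2) by blast+
    then show "card (iso2_maps (rep2 p) (induced A K)) * card (iso2_maps (rep2 q) (induced A (- K))) =
      (if split_classes A K = (p, q) then aut2 (rep2 p) * aut2 (rep2 q) else 0)"
      using card_iso2_maps_eq_aut2[OF P(1) wf(1)] card_iso2_maps_eq_aut2[OF Q(1) wf(2)]
      by (simp add: split_classes_def)
  qed simp
  also have "\<dots> = card {K \<in> comps A. split_classes A K = (p, q)} * (aut2 (rep2 p) * aut2 (rep2 q))"
    using finite_comps[OF A] by (simp add: sum.If_cases Int_def)
  finally show ?thesis .
qed

lemma card_iso2_maps_residue_cong:
  assumes "wf2 G" "wf2 A" "wf2 A'" "iso2 A A'"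
  shows "card (iso2_maps G (residue A)) = card (iso2_maps G (residue A'))"
proof -
  have "iso2 (residue A) (residue A')"
    using assms(4) iso_triple_residue[OF assms(2,3)] iso2_iff[OF assms(2)] iso2_iff[OF wf2_residue[OF assms(2)]]
    by blast
  then show ?thesis
    by (rule card_iso2_maps_target[OF assms(1) wf2_residue[OF assms(2)] wf2_residue[OF assms(3)]])
qed

text \<open>Induction on the vertices. The coefficient of a product at \<open>A\<close> is a sum
  over pairs of classes; the factors \<open>1 / aut2\<close> of the two parts equal the number of
  components of that type divided by \<open>aut2 A\<close>, which turns it into a sum over the
  components of \<open>A\<close>. The isomorphisms from the skeleton satisfy the same recursion when
  \<open>v\<close> is split off.\<close>

lemma sprod_vertices:
  assumes B: "wf2 B"
  shows "wf2 A \<Longrightarrow> distinct vs \<Longrightarrow> set vs \<subseteq> gV B \<Longrightarrow>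
    sprod (map (\<lambda>v d. real (aut1 (vgraph B v)) * Xbd (vgraph B v) d) vs) (cls2 A) =
    real (card (iso2_maps (induced (bare B) (set vs)) (residue A))) / real (aut2 A)"
proof (induction vs arbitrary: A)
  case Nil
  \<comment> \<open>The empty product is the unit series, and the skeleton without vertices has an
    isomorphism to \<open>residue A\<close>, exactly one, precisely when \<open>A\<close> has no
    vertices.\<close>
  have "wf2 (induced (bare B) {})"
    by (rule wf2_induced[OF wf2_bare[OF B]]) (simp add: saturated_def)
  then have "card (iso2_maps (induced (bare B) {}) (residue A)) = (if gV A = {} then 1 else 0)"
    using card_iso2_maps_empty[of "induced (bare B) {}" "residue A"] wf2_residue[OF Nil(1)] by simp
  moreover have "aut2 A = 1" if "gV A = {}"
    using card_iso2_maps_empty[OF Nil(1) that Nil(1)] that by (simp add: aut2_def)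
  ultimately show ?case by (simp add: sprod_def sone_cls2[OF Nil(1)])
next
  case (Cons v vs)
  note A = Cons.prems(1)
  define F where "F = (\<lambda>v d. real (aut1 (vgraph B v)) * Xbd (vgraph B v) d)"
  define I where "I = (\<lambda>P. card (iso2_maps (induced (bare B) {v}) (residue P)))"
  define N where "N = (\<lambda>Q. card (iso2_maps (induced (bare B) (set vs)) (residue Q)))"
  define f where "f = (\<lambda>(p, q). F v p * sprod (map F vs) q)"
  \<comment> \<open>The sum over the components of \<open>A\<close>, grouped by type so that it can
    be compared with \<open>f\<close> term by term.\<close>
  define g where "g = (\<lambda>x. \<Sum>K\<in>{K \<in> comps A. split_classes A K = x}.
    real (I (induced A K)) * real (N (induced A (- K))) / real (aut2 A))"
  define D where "D = {(p, q). p \<in> U2 \<and> q \<in> U2 \<and> cls2 (dunion (rep2 p) (rep2 q)) = cls2 A}"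
  define J where "J = split_classes A ` comps A"
  have wfB: "wf2 (induced (bare B) X)" for X
    by (rule wf2_induced[OF wf2_bare[OF B]]) (simp add: saturated_def bare_def)
  have v: "v \<in> gV B" "v \<notin> set vs" "distinct vs" "set vs \<subseteq> gV B" using Cons.prems by auto
  have pos: "aut2 (rep2 p) \<noteq> 0" if "p \<in> U2" for p using aut2_pos[OF rep2_props(1)[OF that]] by simp
  have posA: "aut2 A \<noteq> 0" using aut2_pos[OF A] by simp
  have fpq: "f (p, q) = (if connected2 (rep2 p) then
      real (I (rep2 p)) / real (aut2 (rep2 p)) * (real (N (rep2 q)) / real (aut2 (rep2 q))) else 0)"
    if "p \<in> U2" "q \<in> U2" for p q
    using aut1_Xbd[OF B v(1) that(1)] Cons.IH[OF rep2_props(1)[OF that(2)] v(3,4)] rep2_props(2)[OF that(2)]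
    by (simp add: f_def F_def I_def N_def)
  \<comment> \<open>Membership in the index set of the product is expressed by a number of
    isomorphisms, so that the splitting formula applies to it.\<close>
  have isoD: "(p, q) \<in> D \<longleftrightarrow> card (iso2_maps (dunion (rep2 p) (rep2 q)) A) \<noteq> 0" if "p \<in> U2" "q \<in> U2" for p q
  proof -
    have "wf2 (dunion (rep2 p) (rep2 q))" using that by (intro wf2_dunion rep2_props)
    then show ?thesis
      using that A cls2_eq_iff[of "dunion (rep2 p) (rep2 q)" A] card_iso2_maps_eq_aut2[of "dunion (rep2 p) (rep2 q)" A]
        aut2_pos[of "dunion (rep2 p) (rep2 q)"]
      by (simp add: D_def)
  qed
  have JK: "p \<in> U2 \<and> q \<in> U2 \<and> wf2 (induced A K) \<and> wf2 (induced A (- K)) \<and>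
      iso2 (induced A K) (rep2 p) \<and> iso2 (induced A (- K)) (rep2 q) \<and> connected2 (rep2 p)"
    if K: "K \<in> comps A" "split_classes A K = (p, q)" for K p q
  proof -
    note s = saturated_comps[OF A K(1)]
    note wf = wf2_induced[OF A s] wf2_induced[OF A saturated_Compl[OF s]]
    have pq: "p = cls2 (induced A K)" "q = cls2 (induced A (- K))" using K(2) by (auto simp: split_classes_def)
    note r = iso2_rep2[OF wf(1)] iso2_rep2[OF wf(2)]
    show ?thesis
      unfolding pq using wf r connected2_iso[OF wf(1) r(1,2) connected2_comps[OF A K(1)]] by simp
  qed
  have "smul (F v) (sprod (map F vs)) (cls2 A) = infsum f D"
    by (simp add: smul_def f_def D_def)
  also have "\<dots> = infsum g J"
  proof (rule infsum_cong_neutral)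
    fix x assume x: "x \<in> D - J"
    obtain p q where pq: "x = (p, q)" by (cases x)
    have U: "p \<in> U2" "q \<in> U2" using x by (auto simp: pq D_def)
    show "f x = 0"
    \<comment> \<open>A pair of \<open>D\<close> that comes from no component has a disconnected
      first part, where \<open>Xbd\<close> vanishes: with a connected one, the splitting formula
      would leave no isomorphism from the disjoint union to \<open>A\<close>.\<close>
    proof (cases "connected2 (rep2 p)")
      case True
      have "split_classes A K \<noteq> (p, q)" if "K \<in> comps A" for K
        using x imageI[OF that, of "split_classes A"] unfolding pq J_def by (metis DiffD2)
      then have "{K \<in> comps A. split_classes A K = (p, q)} = {}" by simp
      then have "card (iso2_maps (dunion (rep2 p) (rep2 q)) A) = 0"
        using card_iso2_maps_dunion_reps[OF A U True] by (simp only: card.empty mult_0)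
      then show ?thesis using isoD[OF U] x by (simp add: pq)
    qed (simp add: pq fpq[OF U])
  next
    fix x assume x: "x \<in> J - D"
    then obtain K where K: "K \<in> comps A" "split_classes A K = x" by (auto simp: J_def)
    obtain p q where pq: "x = (p, q)" by (cases x)
    have U: "p \<in> U2" "q \<in> U2" and con: "connected2 (rep2 p)" using JK[of K p q] K pq by auto
    have "card {K \<in> comps A. split_classes A K = (p, q)} \<noteq> 0"
      using K pq finite_comps[OF A] by auto
    then have "(p, q) \<in> D"
      unfolding isoD[OF U] card_iso2_maps_dunion_reps[OF A U con] using pos[OF U(1)] pos[OF U(2)] by simp
    then show "g x = 0" using x pq by simp
  next
    fix x assume x: "x \<in> D \<inter> J"
    then obtain K where K: "K \<in> comps A" "split_classes A K = x" by (auto simp: J_def)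
    obtain p q where pq: "x = (p, q)" by (cases x)
    have U: "p \<in> U2" "q \<in> U2" and con: "connected2 (rep2 p)" using JK[of K p q] K pq by auto
    let ?n = "card {K \<in> comps A. split_classes A K = (p, q)}"
    have dA: "wf2 (dunion (rep2 p) (rep2 q))" "iso2 (dunion (rep2 p) (rep2 q)) A"
      using x cls2_eq_iff[OF wf2_dunion[OF rep2_props(1)[OF U(1)] rep2_props(1)[OF U(2)]] A]
      by (auto simp: pq D_def intro!: wf2_dunion rep2_props(1))
    \<comment> \<open>There are \<open>aut2 A\<close> isomorphisms from the disjoint union to
      \<open>A\<close>; splitting them brings in the multiplicity of the pair.\<close>
    have "aut2 A = ?n * (aut2 (rep2 p) * aut2 (rep2 q))"
      using card_iso2_maps_dunion_reps[OF A U con] card_iso2_maps_eq_aut2[OF dA(1) A] dA(2)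
        aut2_cong[OF dA(1) A dA(2)] by simp
    then have aut: "real (aut2 A) = real ?n * (real (aut2 (rep2 p)) * real (aut2 (rep2 q)))"
      by (simp flip: of_nat_mult)
    then have n: "real ?n \<noteq> 0" using posA by (metis mult_zero_left of_nat_eq_0_iff)
    have "g x = (\<Sum>K\<in>{K \<in> comps A. split_classes A K = (p, q)}.
        real (I (rep2 p)) * real (N (rep2 q)) / real (aut2 A))"
      unfolding g_def pq
    proof (rule sum.cong)
      fix K assume "K \<in> {K \<in> comps A. split_classes A K = (p, q)}"
      then have "iso2 (induced A K) (rep2 p)" "iso2 (induced A (- K)) (rep2 q)"
        "wf2 (induced A K)" "wf2 (induced A (- K))" using JK by auto
      then have "I (induced A K) = I (rep2 p)" "N (induced A (- K)) = N (rep2 q)"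
        unfolding I_def N_def
        using rep2_props(1)[OF U(1)] rep2_props(1)[OF U(2)] wfB by (blast intro: card_iso2_maps_residue_cong)+
      then show "real (I (induced A K)) * real (N (induced A (- K))) / real (aut2 A) =
        real (I (rep2 p)) * real (N (rep2 q)) / real (aut2 A)" by simp
    qed simp
    also have "\<dots> = real ?n * (real (I (rep2 p)) * real (N (rep2 q)) / real (aut2 A))" by simp
    also have "\<dots> = f x"
      unfolding aut using n con by (simp add: pq fpq[OF U] field_simps)
    finally show "f x = g x" ..
  qed
  also have "\<dots> = sum g J" using finite_comps[OF A] by (simp add: J_def)
  also have "\<dots> = (\<Sum>K\<in>comps A. real (I (induced A K)) * real (N (induced A (- K))) / real (aut2 A))"
    unfolding J_def g_def by (rule sum.image_gen[OF finite_comps[OF A], symmetric])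
  also have "\<dots> = real (card (iso2_maps (induced (bare B) (insert v (set vs))) (residue A))) / real (aut2 A)"
    unfolding card_iso2_maps_bare_insert[OF B A v(1,2)] I_def N_def by (simp add: sum_divide_distrib)
  finally show ?case by (simp add: sprod_def F_def)
qed

section \<open>Comparison of the two coefficients\<close>

theorem mainTheorem5:
  shows "\<forall>a\<in>U2. \<forall>b\<in>U2.
    (\<Sum>\<^sub>\<infinity>c\<in>U2. Xall c * real (delta_coeff (rep2 c) a b)) =
    (\<Sum>\<^sub>\<infinity>c\<in>U2.
       sprod (map (\<lambda>v. (\<lambda>d. real (aut1 (vgraph (rep2 c) v)) * Xbd (vgraph (rep2 c) v) d))
                  (sorted_list_of_set (gV (rep2 c)))) a
       * (if b = c then Xall c else 0))"
proof (intro ballI)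
  fix a b assume a: "a \<in> U2" and b: "b \<in> U2"
  let ?A = "rep2 a" and ?B = "rep2 b"
  note A = rep2_props[OF a] and B = rep2_props[OF b]
  define s where "s = (\<lambda>c. sprod (map (\<lambda>v. (\<lambda>d. real (aut1 (vgraph (rep2 c) v)) * Xbd (vgraph (rep2 c) v) d))
                  (sorted_list_of_set (gV (rep2 c)))) a)"
  have "(\<Sum>\<^sub>\<infinity>c\<in>U2. s c * (if b = c then Xall c else 0)) = (\<Sum>\<^sub>\<infinity>c\<in>{b}. s c * (if b = c then Xall c else 0))"
    by (rule infsum_cong_neutral) (use b in auto)
  \<comment> \<open>Only \<open>c = b\<close> has \<open>b\<close> as its right tensor
    factor.\<close>
  also have "\<dots> = s b * Xall b" by simp
  also have "s b = real (card (iso2_maps (induced (bare ?B) (gV ?B)) (residue ?A))) / real (aut2 ?A)"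
    using sprod_vertices[OF B(1) A(1), of "sorted_list_of_set (gV ?B)"] A(2) B(1) by (simp add: s_def)
  \<comment> \<open>The product runs over all vertices of \<open>B\<close>, so the part of the
    skeleton that it sees is the whole skeleton.\<close>
  also have "induced (bare ?B) (gV ?B) = bare ?B"
    using B(1) by (simp add: induced_def bare_def rewire_def Collect_conj_eq cong: conj_cong)
  finally have rhs: "(\<Sum>\<^sub>\<infinity>c\<in>U2. s c * (if b = c then Xall c else 0)) =
      real (card (iso2_maps (bare ?B) (residue ?A))) / (real (aut2 ?A) * real (aut2 ?B))"
    by (simp add: Xall_def)
  show "(\<Sum>\<^sub>\<infinity>c\<in>U2. Xall c * real (delta_coeff (rep2 c) a b)) =
    (\<Sum>\<^sub>\<infinity>c\<in>U2.
       sprod (map (\<lambda>v. (\<lambda>d. real (aut1 (vgraph (rep2 c) v)) * Xbd (vgraph (rep2 c) v) d))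
                  (sorted_list_of_set (gV (rep2 c)))) a
       * (if b = c then Xall c else 0))"
    using infsum_subgraphs[OF A(1) B(1)] rhs unfolding A(2) B(2) s_def by simp
qed

end
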